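(* Let $n\ge 1$ and let $L:\mathbb{R}[\underline{x}]\to\mathbb{R}$ be a linear map which is PSD. Suppose that for each $j=1,\dots,n-1$ there exists a sequence $\{q_{jk}\}_{k=1}^{\infty}$ in $\mathbb{C}[\underline{x}]$ such that $$\lim_{k\to\infty} L\big(|1-(1+x_j^2)q_{jk}\overline{q_{jk}}|^2\big)=0.$$ Then there exists a positive Borel measure $\mu$ on $\mathbb{R}^n$ such that $L=L_\mu$. If, in addition, there exists a sequence $\{q_{nk}\}_{k=1}^{\infty}$ in $\mathbb{C}[\underline{x}]$ such that $$\lim_{k\to\infty} L\big(|1-(1+x_n^2)q_{nk}\overline{q_{nk}}|^2\big)=0,$$ then the measure $\mu$ is determinate.
   Context: Notation: $\mathbb{R}[\underline{x}]:=\mathbb{R}[x_1,\dots,x_n]$ and $\mathbb{C}[\underline{x}]:=\mathbb{C}[x_1,\dots,x_n]$. For $f=f_1+if_2\in\mathbb{C}[\underline{x}]$ with $f_1,f_2\in\mathbb{R}[\underline{x}]$, $\overline{f}:=f_1-if_2$ and $|f|^2:=f\overline{f}=f_1^2+f_2^2\in\mathbb{R}[\underline{x}]$. A linear map $L:\mathbb{R}[\underline{x}]\to\mathbb{R}$ is PSD (positive semidefinite) if $L(f^2)\ge 0$ for all $f\in\mathbb{R}[\underline{x}]$. If $\mu$ is a positive Borel measure on $\mathbb{R}^n$ having finite moments (i.e. $\int x_1^{k_1}\cdots x_n^{k_n}\,d\mu$ is well-defined and finite for all integers $k_1,\dots,k_n\ge 0$), then $L_\mu:\mathbb{R}[\underline{x}]\to\mathbb{R}$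 is the linear map $L_\mu(f):=\int f\,d\mu$; the equation $L=L_\mu$ includes the assertion that $\mu$ has finite moments. Such a measure $\mu$ is called determinate if, for every positive Borel measure $\nu$ on $\mathbb{R}^n$ having finite moments, $L_\mu=L_\nu$ implies $\mu=\nu$. *)

theory Defs
  imports "HOL-Analysis.Analysis" "HOL-Analysis.Finite_Function_Topology"
begin

(* The polynomial ring over 'a in indeterminates indexed by the finite type 'n: finitely supported
   coefficient functions on the monoid of exponent vectors.  Multiplication is the library's
   convolution product, and for 'a = real the library's coefficientwise scaleR makes it a real
   vector space, so that "linear" applies. *)
type_synonym ('n, 'a) mpoly = "('n \<Rightarrow>\<^sub>0 nat) \<Rightarrow>\<^sub>0 'a"

definition X :: "'n \<Rightarrow> ('n, 'a::comm_semiring_1) mpoly"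
  where "X j = Poly_Mapping.single (Poly_Mapping.single j 1) 1"

definition mpoly_eval :: "('n::finite, 'a::comm_semiring_1) mpoly \<Rightarrow> 'a ^ 'n \<Rightarrow> 'a"
  where "mpoly_eval p x =
    (\<Sum>m \<in> Poly_Mapping.keys p.
       Poly_Mapping.lookup p m * (\<Prod>i \<in> UNIV. x $ i ^ Poly_Mapping.lookup m i))"

definition mpoly_Re :: "('n, complex) mpoly \<Rightarrow> ('n, real) mpoly"
  where "mpoly_Re f = Poly_Mapping.map Re f"

definition mpoly_Im :: "('n, complex) mpoly \<Rightarrow> ('n, real) mpoly"
  where "mpoly_Im f = Poly_Mapping.map Im f"

definition mpoly_of_real :: "('n, real) mpoly \<Rightarrow> ('n, complex) mpoly"
  where "mpoly_of_real f = Poly_Mapping.map complex_of_real f"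

definition mpoly_cnj :: "('n, complex) mpoly \<Rightarrow> ('n, complex) mpoly"
  where "mpoly_cnj f = Poly_Mapping.map cnj f"

(* |f|^2 as an element of the real polynomial ring; mpoly_abs_sq_eq below identifies it with
   f * mpoly_cnj f. *)
definition mpoly_abs_sq :: "('n, complex) mpoly \<Rightarrow> ('n, real) mpoly"
  where "mpoly_abs_sq f = (mpoly_Re f)\<^sup>2 + (mpoly_Im f)\<^sup>2"

lemma lookup_mpoly_map:
  "Poly_Mapping.lookup (mpoly_Re f) m = Re (Poly_Mapping.lookup f m)"
  "Poly_Mapping.lookup (mpoly_Im f) m = Im (Poly_Mapping.lookup f m)"
  "Poly_Mapping.lookup (mpoly_of_real g) m = complex_of_real (Poly_Mapping.lookup g m)"
  "Poly_Mapping.lookup (mpoly_cnj f) m = cnj (Poly_Mapping.lookup f m)"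
  by (auto simp: mpoly_Re_def mpoly_Im_def mpoly_of_real_def mpoly_cnj_def
      Poly_Mapping.map.rep_eq when_def)

lemma mpoly_of_real_zero: "mpoly_of_real 0 = 0"
  by (rule poly_mapping_eqI) (simp add: lookup_mpoly_map)

lemma mpoly_of_real_add: "mpoly_of_real (p + q) = mpoly_of_real p + mpoly_of_real q"
  by (rule poly_mapping_eqI) (simp add: lookup_mpoly_map lookup_add)

lemma mpoly_of_real_single:
  "mpoly_of_real (Poly_Mapping.single m c) = Poly_Mapping.single m (complex_of_real c)"
  by (rule poly_mapping_eqI) (simp add: lookup_mpoly_map lookup_single when_def)

lemma mpoly_add_induct [case_names zero add]:
  fixes p :: "('n, 'a::comm_semiring_1) mpoly"
  assumes "P 0" and step: "\<And>m c p. P p \<Longrightarrow> P (Poly_Mapping.single m c + p)"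
  shows "P p"
proof (induction p rule: update_induct)
  case const
  then show ?case by (rule assms(1))
next
  case (update f a b)
  have "Poly_Mapping.update a b f = Poly_Mapping.single a b + f"
    using update(1)
    by (intro poly_mapping_eqI)
      (auto simp: lookup_update lookup_add lookup_single when_def in_keys_iff)
  then show ?case using step update by simp
qed

lemma mpoly_of_real_mult: "mpoly_of_real (p * q) = mpoly_of_real p * mpoly_of_real q"
proof (induction p rule: mpoly_add_induct)
  case zero
  show ?case by (simp add: mpoly_of_real_zero)
next
  case (add m c p)
  have "mpoly_of_real (Poly_Mapping.single m c * q)
      = mpoly_of_real (Poly_Mapping.single m c) * mpoly_of_real q"
  proof (induction q rule: mpoly_add_induct)
    case zero
    show ?case by (simp add: mpoly_of_real_zero)
  next
    case (add m' c' q)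
    then show ?case
      by (simp add: distrib_left mpoly_of_real_add mult_single mpoly_of_real_single)
  qed
  with add show ?case by (simp add: distrib_right mpoly_of_real_add)
qed

lemma mpoly_abs_sq_eq:
  fixes f :: "('n, complex) mpoly"
  shows "mpoly_of_real (mpoly_abs_sq f) = f * mpoly_cnj f"
proof -
  define I :: "('n, complex) mpoly" where "I = Poly_Mapping.single 0 \<i>"
  define u v where "u = mpoly_of_real (mpoly_Re f)" and "v = mpoly_of_real (mpoly_Im f)"
  have I: "Poly_Mapping.lookup (I * p) m = \<i> * Poly_Mapping.lookup p m" for p m
    unfolding I_def mult_map_scale_conv_mult [symmetric]
    by (simp add: Poly_Mapping.map.rep_eq when_def)
  have f: "f = u + I * v"
    by (rule poly_mapping_eqI) (simp add: u_def v_def lookup_add I lookup_mpoly_map complex_eq)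
  have g: "mpoly_cnj f = u - I * v"
    by (rule poly_mapping_eqI)
      (simp add: u_def v_def lookup_minus I lookup_mpoly_map complex_eq_iff)
  have II: "I * I = - 1"
    by (simp add: I_def mult_single flip: single_uminus single_one)
  have "f * mpoly_cnj f = u * u - (I * I) * (v * v)"
    unfolding g by (subst f) (simp add: algebra_simps)
  then show ?thesis
    by (simp add: II mpoly_abs_sq_def power2_eq_square mpoly_of_real_add mpoly_of_real_mult u_def v_def)
qed

definition psd :: "(('n, real) mpoly \<Rightarrow> real) \<Rightarrow> bool"
  where "psd L \<longleftrightarrow> (\<forall>f. L (f\<^sup>2) \<ge> 0)"

definition borel_measure :: "(real ^ 'n::finite) measure \<Rightarrow> bool"
  where "borel_measure \<mu> \<longleftrightarrow> sets \<mu> = sets borel"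

definition finite_moments :: "(real ^ 'n::finite) measure \<Rightarrow> bool"
  where "finite_moments \<mu> \<longleftrightarrow> (\<forall>k::'n \<Rightarrow> nat. integrable \<mu> (\<lambda>x. \<Prod>i \<in> UNIV. x $ i ^ k i))"

(* The functional L_mu; meaningful only under finite_moments, since the Bochner integral of a
   non-integrable function is 0. *)
definition moment_functional :: "(real ^ 'n::finite) measure \<Rightarrow> ('n, real) mpoly \<Rightarrow> real"
  where "moment_functional \<mu> f = (\<integral>x. mpoly_eval f x \<partial>\<mu>)"

(* "mu is a positive Borel measure with L = L_mu", including the assertion that mu has finite
   moments. *)
definition represents :: "(real ^ 'n::finite) measure \<Rightarrow> (('n, real) mpoly \<Rightarrow> real) \<Rightarrow> bool"
  where "represents \<mu> L \<longleftrightarrow> borel_measure \<mu> \<and> finite_moments \<mu> \<and> L = moment_functional \<mu>"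

definition determinate :: "(real ^ 'n::finite) measure \<Rightarrow> bool"
  where "determinate \<mu> \<longleftrightarrow>
    (\<forall>\<nu>. borel_measure \<nu> \<and> finite_moments \<nu> \<and> moment_functional \<mu> = moment_functional \<nu>
      \<longrightarrow> \<mu> = \<nu>)"

end

theory Submission
  imports Defs "HOL-Probability.Probability" "HOL-Computational_Algebra.Fundamental_Theorem_Algebra"
    "HOL-Real_Asymp.Real_Asymp"
begin

text \<open>
  Write \<open>p j = 1 + (X j)\<^sup>2\<close>.  If \<open>p j * Q k\<close> tends to 1 in the seminorm given by \<open>L\<close>, where \<open>Q k\<close> is
  a sum of squares, then \<open>f \<mapsto> lim L (f * Q k)\<close> is a positive semidefinite functional which plays
  the role of \<open>L (f / p j)\<close>; iterating, \<open>L\<close> extends to all fractions with denominator a product of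
  powers of the \<open>p j\<close>.

  Existence: in a localized variable \<open>x\<close>, the kernels \<open>((1 + t * x)\<^sup>2 / (1 + x\<^sup>2)) ^ N\<close> are sums of
  squares in the localization, and on the circle \<open>x = tan \<alpha>\<close> they are de la Vallee Poussin kernels.  Applying \<open>L\<close> to
  products of such kernels, with \<open>t\<close> running through finitely many nodes, discretizes all variables
  but the last.  What remains for each choice of nodes is a positive semidefinite functional in the
  last variable only; a nonnegative univariate polynomial being a sum of two squares, its moments
  of bounded degree are approximated by those of atomic measures.  So the values of \<open>L\<close> on monomials
  are limits of moments of atomic measures on Euclidean space.  Coding points by real numbers, with a continuous
  decoding map, makes Helly's selection theorem on the line yield the representing measure.

  Determinacy: if \<open>\<nu>\<close> and \<open>\<mu>\<close> represent \<open>L\<close>, then \<open>Q k\<close> tends to \<open>1 / p j\<close> in both \<open>L\<^sup>2\<close> spaces, so the two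
  measures agree on all fractions, and the bounded ones determine a finite measure by the
  Stone-Weierstrass theorem.
\<close>

section \<open>Polynomial rings\<close>

definition Const :: "'a::comm_semiring_1 \<Rightarrow> ('n, 'a) mpoly"
  where "Const c = Poly_Mapping.single 0 c"

lemma Const_hom:
  "Const 0 = 0" "Const 1 = 1" "Const (a + b) = Const a + Const b" "Const (a * b) = Const a * Const b"
  by (simp_all add: Const_def mult_single single_add)

lemma Const_prod: "Const (\<Prod>i\<in>A. f i) = (\<Prod>i\<in>A. Const (f i))"
  by (induction A rule: infinite_finite_induct) (simp_all add: Const_hom)

lemma lookup_Const_mult: "Poly_Mapping.lookup (Const c * p) m = c * Poly_Mapping.lookup p m"
  unfolding Const_def mult_map_scale_conv_mult [symmetric]
  by (simp add: Poly_Mapping.map.rep_eq when_def)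

text \<open>Scalar multiplication becomes a ring product, so that linearity of a functional can be
  used by ring rewriting.\<close>

lemma scaleR_eq_Const_mult: "c *\<^sub>R p = Const c * p" for p :: "('n, real) mpoly"
proof (rule poly_mapping_eqI)
  fix m
  have "finite {i. c *\<^sub>R Poly_Mapping.lookup p i \<noteq> 0}"
    by (rule finite_subset [OF _ finite_lookup [of p]]) auto
  then show "Poly_Mapping.lookup (c *\<^sub>R p) m = Poly_Mapping.lookup (Const c * p) m"
    by (simp add: scaleR_poly_mapping_def lookup_Const_mult)
qed

lemma linear_Const_mult: "linear L \<Longrightarrow> L (Const c * p) = c * L p"
  for L :: "('n, real) mpoly \<Rightarrow> real"
  by (simp add: linear_scale flip: scaleR_eq_Const_mult)

lemma mpoly_eval_superset:
  assumes "finite A" "Poly_Mapping.keys p \<subseteq> A"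
  shows "mpoly_eval p x = (\<Sum>m\<in>A. Poly_Mapping.lookup p m * (\<Prod>i\<in>UNIV. x $ i ^ Poly_Mapping.lookup m i))"
  unfolding mpoly_eval_def using assms
  by (intro sum.mono_neutral_left) (auto simp: in_keys_iff)

lemma mpoly_eval_0: "mpoly_eval 0 x = 0"
  by (simp add: mpoly_eval_def)

lemma mpoly_eval_add: "mpoly_eval (p + q) x = mpoly_eval p x + mpoly_eval q x"
proof -
  let ?A = "Poly_Mapping.keys p \<union> Poly_Mapping.keys q"
  have "finite ?A" "Poly_Mapping.keys (p + q) \<subseteq> ?A"
    using keys_add [of p q] by auto
  then show ?thesis
    by (simp add: mpoly_eval_superset [of ?A] lookup_add distrib_right sum.distrib)
qed

lemma mpoly_eval_single:
  "mpoly_eval (Poly_Mapping.single m c) x = c * (\<Prod>i\<in>UNIV. x $ i ^ Poly_Mapping.lookup m i)"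
  by (subst mpoly_eval_superset [of "{m}"]) (auto simp: in_keys_iff)

lemma mpoly_eval_mult: "mpoly_eval (p * q) x = mpoly_eval p x * mpoly_eval q x"
proof (induction p rule: mpoly_add_induct)
  case zero
  show ?case by (simp add: mpoly_eval_0)
next
  case (add m c p)
  have "mpoly_eval (Poly_Mapping.single m c * q) x
      = mpoly_eval (Poly_Mapping.single m c) x * mpoly_eval q x"
  proof (induction q rule: mpoly_add_induct)
    case zero
    show ?case by (simp add: mpoly_eval_0)
  next
    case (add m' c' q)
    then show ?case
      by (simp add: distrib_left mpoly_eval_add mult_single mpoly_eval_single lookup_add
          power_add prod.distrib mult_ac)
  qed
  with add show ?case by (simp add: distrib_right mpoly_eval_add)
qed

lemma mpoly_eval_Const: "mpoly_eval (Const c) x = c"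
  by (simp add: Const_def mpoly_eval_single)

lemma mpoly_eval_1: "mpoly_eval 1 x = 1"
  using mpoly_eval_Const [of 1 x] by (simp add: Const_hom)

lemma mpoly_eval_X: "mpoly_eval (X j) x = x $ j"
proof -
  have "(\<Prod>i\<in>UNIV. x $ i ^ Poly_Mapping.lookup (Poly_Mapping.single j 1) i)
      = (\<Prod>i\<in>UNIV. if i = j then x $ j else 1)"
    by (intro prod.cong) (auto simp: lookup_single when_def)
  then show ?thesis by (simp add: X_def mpoly_eval_single)
qed

lemma mpoly_eval_power: "mpoly_eval (p ^ k) x = mpoly_eval p x ^ k"
  by (induction k) (simp_all add: mpoly_eval_1 mpoly_eval_mult)

lemma mpoly_eval_diff: "mpoly_eval (p - q) x = mpoly_eval p x - mpoly_eval q x"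
  for p :: "('n::finite, 'a::comm_ring_1) mpoly"
  using mpoly_eval_add [of "p - q" q x] by simp

lemma mpoly_eval_prod: "mpoly_eval (\<Prod>i\<in>A. f i) x = (\<Prod>i\<in>A. mpoly_eval (f i) x)"
  by (induction A rule: infinite_finite_induct) (simp_all add: mpoly_eval_1 mpoly_eval_mult)

lemmas mpoly_eval_simps = mpoly_eval_0 mpoly_eval_1 mpoly_eval_add mpoly_eval_diff mpoly_eval_mult
  mpoly_eval_power mpoly_eval_Const mpoly_eval_X mpoly_eval_prod

lemma X_power: "X j ^ k = Poly_Mapping.single (Poly_Mapping.single j k) 1"
  by (induction k) (simp_all add: X_def mult_single flip: single_add)

lemma single_eq_Const_mult:
  fixes m :: "'n::finite \<Rightarrow>\<^sub>0 nat"
  shows "Poly_Mapping.single m c = Const c * (\<Prod>i\<in>UNIV. X i ^ Poly_Mapping.lookup m i)"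
proof -
  have prod: "(\<Prod>i\<in>A. Poly_Mapping.single (f i) 1) = Poly_Mapping.single (\<Sum>i\<in>A. f i) (1 :: 'a)"
    if "finite A" for A and f :: "'n \<Rightarrow> 'n \<Rightarrow>\<^sub>0 nat"
    using that by (induction A) (simp_all add: mult_single)
  have "(\<Sum>i\<in>UNIV. Poly_Mapping.single i (Poly_Mapping.lookup m i)) = m"
    by (rule poly_mapping_eqI) (simp add: lookup_sum lookup_single when_def)
  then show ?thesis
    by (simp add: X_power prod Const_def mult_single)
qed

lemma linear_mpoly_ext:
  fixes L M :: "('n::finite, real) mpoly \<Rightarrow> real"
  assumes "linear L" "linear M"
    and eq: "\<And>a :: 'n \<Rightarrow> nat. L (\<Prod>i\<in>UNIV. X i ^ a i) = M (\<Prod>i\<in>UNIV. X i ^ a i)"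
  shows "L = M"
proof
  fix p show "L p = M p"
    by (induction p rule: mpoly_add_induct)
      (simp_all add: assms linear_0 linear_add single_eq_Const_mult linear_Const_mult)
qed

lemma mpoly_of_real_hom: "mpoly_of_real 1 = 1" "mpoly_of_real (X j) = X j"
  "mpoly_of_real (p - q) = mpoly_of_real p - mpoly_of_real q"
  using mpoly_of_real_single [of 0 1] mpoly_of_real_single [of "Poly_Mapping.single j 1" 1]
  by (simp_all add: X_def) (rule poly_mapping_eqI, simp add: lookup_mpoly_map lookup_minus)

lemma mpoly_abs_sq_of_real: "mpoly_abs_sq (mpoly_of_real f) = f\<^sup>2"
proof -
  have "mpoly_Re (mpoly_of_real f) = f" "mpoly_Im (mpoly_of_real f) = 0"
    by (rule poly_mapping_eqI; simp add: lookup_mpoly_map)+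
  then show ?thesis by (simp add: mpoly_abs_sq_def)
qed

text \<open>Since \<open>q * mpoly_cnj q\<close> is real, so is the polynomial inside the modulus,
  and the hypothesis of the theorem becomes one about squares of real polynomials.\<close>

lemma mpoly_abs_sq_one_minus:
  "mpoly_abs_sq (1 - (1 + (X j)\<^sup>2) * q * mpoly_cnj q) = (1 - (1 + (X j)\<^sup>2) * mpoly_abs_sq q)\<^sup>2"
proof -
  have "1 - (1 + (X j)\<^sup>2) * q * mpoly_cnj q
      = mpoly_of_real (1 - (1 + (X j)\<^sup>2) * mpoly_abs_sq q)"
    by (simp add: mpoly_of_real_hom mpoly_of_real_add mpoly_of_real_mult power2_eq_square
        mpoly_abs_sq_eq mult.assoc)
  then show ?thesis by (simp add: mpoly_abs_sq_of_real)
qed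

section \<open>Localization\<close>

lemma psd_add_sq:
  assumes "linear L" "psd L"
  shows "L (a\<^sup>2) \<le> L (a\<^sup>2 + b\<^sup>2)"
  using assms(2) by (simp add: psd_def linear_add [OF assms(1)])

text \<open>The quadratic polynomial \<open>L ((f + Const t * g)^2)\<close> in \<open>t\<close> is
  nonnegative. Its value at the minimiser gives the inequality; if the leading coefficient vanishes,
  the linear one must vanish too.\<close>

lemma psd_Cauchy_Schwarz:
  fixes L :: "('n, real) mpoly \<Rightarrow> real"
  assumes L: "linear L" and "psd L"
  shows "(L (f * g))\<^sup>2 \<le> L (f\<^sup>2) * L (g\<^sup>2)"
proof -
  have quad: "0 \<le> L (f\<^sup>2) + 2 * t * L (f * g) + t\<^sup>2 * L (g\<^sup>2)" for t
  proof -
    have "(Const (2 * t) :: ('n, real) mpoly) = Const t + Const t"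
      by (simp flip: Const_hom(3))
    moreover have "(f + c * g)\<^sup>2 = f\<^sup>2 + ((c + c) * (f * g) + (c * c) * g\<^sup>2)" for c
      by (simp add: power2_eq_square algebra_simps)
    ultimately have "(f + Const t * g)\<^sup>2 = f\<^sup>2 + (Const (2 * t) * (f * g) + Const (t\<^sup>2) * g\<^sup>2)"
      by (simp only: power2_eq_square [of t] Const_hom(4) [of t t])
    then have "L ((f + Const t * g)\<^sup>2) = L (f\<^sup>2) + (2 * t * L (f * g) + t\<^sup>2 * L (g\<^sup>2))"
      by (simp only: linear_add [OF L] linear_Const_mult [OF L])
    moreover have "0 \<le> L ((f + Const t * g)\<^sup>2)"
      using \<open>psd L\<close> by (simp add: psd_def)
    ultimately show ?thesis by simp
  qed
  show ?thesis
  proof (cases "L (g\<^sup>2) = 0")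
    case True
    have "L (f * g) = 0"
    proof (rule ccontr)
      assume "L (f * g) \<noteq> 0"
      then show False
        \<comment> \<open>At this \<open>t\<close> the affine function
          \<open>L (f^2) + 2 * t * L (f * g)\<close> equals -1.\<close>
        using quad [of "- (L (f\<^sup>2) + 1) / (2 * L (f * g))"] True by (simp add: field_simps)
    qed
    with True show ?thesis by simp
  next
    case False
    then have "L (g\<^sup>2) > 0"
      using \<open>psd L\<close> by (simp add: psd_def less_le)
    then show ?thesis
      using quad [of "- L (f * g) / L (g\<^sup>2)"]
      by (simp add: field_simps power2_eq_square)
  qed
qed

text \<open>\<open>Q k\<close> imitates the inverse of \<open>1 + (X j)^2\<close> in the seminorm of
  \<open>L\<close>. Sums of two real squares in place of \<open>q * mpoly_cnj q\<close> keep complex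
  polynomials in several variables out of the rest of the proof.\<close>

definition localizable :: "(('n, real) mpoly \<Rightarrow> real) \<Rightarrow> 'n \<Rightarrow> bool"
  where "localizable L j \<longleftrightarrow> (\<exists>Q. (\<forall>k. \<exists>a b. Q k = a\<^sup>2 + b\<^sup>2) \<and>
    (\<lambda>k. L ((1 - (1 + (X j)\<^sup>2) * Q k)\<^sup>2)) \<longlonglongrightarrow> 0)"

text \<open>The same \<open>Q\<close> serves for \<open>M\<close>. This keeps the remaining
  variables localizable after a localization, so that localizations can be iterated.\<close>

lemma localizable_mono:
  assumes "localizable L j" "psd M" "\<And>g. M (g\<^sup>2) \<le> L (g\<^sup>2)"
  shows "localizable M j"
proof -
  obtain Q where Q: "\<forall>k. \<exists>a b. Q k = a\<^sup>2 + b\<^sup>2"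
    and lim: "(\<lambda>k. L ((1 - (1 + (X j)\<^sup>2) * Q k)\<^sup>2)) \<longlonglongrightarrow> 0"
    using assms(1) by (auto simp: localizable_def)
  have "(\<lambda>k. M ((1 - (1 + (X j)\<^sup>2) * Q k)\<^sup>2)) \<longlonglongrightarrow> 0"
    using assms(2) by (intro tendsto_sandwich [OF _ _ tendsto_const lim]) (auto simp: psd_def assms)
  with Q show ?thesis by (auto simp: localizable_def)
qed

text \<open>\<open>M f\<close> plays the role of \<open>L (f / (1 + (X j)\<^sup>2))\<close>; it is the limit of \<open>L (f * Q k)\<close>.\<close>

lemma localize:
  fixes L :: "('n, real) mpoly \<Rightarrow> real"
  assumes L: "linear L" "psd L" and "localizable L j"
  obtains M where "linear M" "psd M" "\<And>f. M ((1 + (X j)\<^sup>2) * f) = L f" "\<And>g. M (g\<^sup>2) \<le> L (g\<^sup>2)"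
proof -
  define p :: "('n, real) mpoly" where "p = 1 + (X j)\<^sup>2"
  obtain Q where sos: "\<And>k. \<exists>a b. Q k = a\<^sup>2 + b\<^sup>2"
    and lim: "(\<lambda>k. L ((1 - p * Q k)\<^sup>2)) \<longlonglongrightarrow> 0"
    using assms(3) by (auto simp: localizable_def p_def)
  \<comment> \<open>\<open>p^2 - 1\<close> is a sum of squares, so multiplication by
    \<open>p\<close> does not decrease the seminorm; a bound for \<open>p * (Q k - Q m)\<close> is
    therefore also one for \<open>Q k - Q m\<close>.\<close>
  have p_ge: "L (q\<^sup>2) \<le> L ((p * q)\<^sup>2)" for q
  proof -
    have "(p * q)\<^sup>2 = q\<^sup>2 + ((X j * q)\<^sup>2 + ((X j * q)\<^sup>2 + ((X j)\<^sup>2 * q)\<^sup>2))"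
      by (simp add: p_def power2_eq_square algebra_simps)
    then have "L ((p * q)\<^sup>2) = L (q\<^sup>2) + (L ((X j * q)\<^sup>2) + (L ((X j * q)\<^sup>2) + L (((X j)\<^sup>2 * q)\<^sup>2)))"
      by (simp only: linear_add [OF L(1)])
    moreover have "0 \<le> L (g\<^sup>2)" for g using L by (simp add: psd_def)
    ultimately show ?thesis by simp
  qed
  \<comment> \<open>Cauchy-Schwarz reduces the claim to \<open>Q k - Q m\<close>, and the
    parallelogram law bounds \<open>v - u\<close> by the two errors.\<close>
  have diff: "(L (f * (Q k - Q m)))\<^sup>2
      \<le> L (f\<^sup>2) * (2 * L ((1 - p * Q k)\<^sup>2) + 2 * L ((1 - p * Q m)\<^sup>2))" for f k m
  proof -
    define u v where "u = 1 - p * Q k" and "v = 1 - p * Q m"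
    have "p * (Q k - Q m) = v - u"
      by (simp add: u_def v_def right_diff_distrib)
    moreover have "(v - u)\<^sup>2 + (v + u)\<^sup>2 = (u\<^sup>2 + u\<^sup>2) + (v\<^sup>2 + v\<^sup>2)"
      by (simp add: power2_eq_square algebra_simps)
    then have "L ((v - u)\<^sup>2) + L ((v + u)\<^sup>2) = 2 * L (u\<^sup>2) + 2 * L (v\<^sup>2)"
      unfolding mult_2 linear_add [OF L(1), symmetric] by simp
    moreover have "L ((v + u)\<^sup>2) \<ge> 0" using L by (simp add: psd_def)
    ultimately have "L ((Q k - Q m)\<^sup>2) \<le> 2 * L ((1 - p * Q k)\<^sup>2) + 2 * L ((1 - p * Q m)\<^sup>2)"
      using p_ge [of "Q k - Q m"] unfolding u_def v_def by simp
    then have "L (f\<^sup>2) * L ((Q k - Q m)\<^sup>2)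
        \<le> L (f\<^sup>2) * (2 * L ((1 - p * Q k)\<^sup>2) + 2 * L ((1 - p * Q m)\<^sup>2))"
      using L by (intro mult_left_mono) (auto simp: psd_def)
    with psd_Cauchy_Schwarz [OF L, of f "Q k - Q m"] show ?thesis by linarith
  qed
  have conv: "convergent (\<lambda>k. L (f * Q k))" for f
  proof (rule Cauchy_convergent, rule metric_CauchyI)
    fix e :: real assume "e > 0"
    \<comment> \<open>The summand 1 keeps the denominator positive when
      \<open>L (f^2) = 0\<close>.\<close>
    define c where "c = L (f\<^sup>2) + 1"
    have c: "L (f\<^sup>2) < c" "0 < c" using L by (simp_all add: c_def psd_def add_nonneg_pos)
    have "\<forall>\<^sub>F k in sequentially. L ((1 - p * Q k)\<^sup>2) < e\<^sup>2 / (4 * c)"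
      using c \<open>e > 0\<close> by (intro order_tendstoD(2) [OF lim]) simp
    then obtain n where n: "\<And>k. k \<ge> n \<Longrightarrow> L ((1 - p * Q k)\<^sup>2) < e\<^sup>2 / (4 * c)"
      by (auto simp: eventually_sequentially)
    have "dist (L (f * Q k)) (L (f * Q m)) < e" if "k \<ge> n" "m \<ge> n" for k m
    proof -
      let ?t = "2 * L ((1 - p * Q k)\<^sup>2) + 2 * L ((1 - p * Q m)\<^sup>2)"
      have "?t \<ge> 0" using L by (simp add: psd_def)
      have "(L (f * (Q k - Q m)))\<^sup>2 \<le> c * ?t"
        using diff [of f k m] mult_right_mono [OF less_imp_le [OF c(1)] \<open>?t \<ge> 0\<close>] by linarith
      also have "\<dots> < c * (e\<^sup>2 / c)"
        using n [OF that(1)] n [OF that(2)] c(2) by (intro mult_strict_left_mono) (simp_all add: field_simps)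
      also have "\<dots> = e\<^sup>2" using c by simp
      finally have "\<bar>L (f * (Q k - Q m))\<bar> < e"
        using \<open>e > 0\<close> by (metis abs_le_square_iff abs_of_pos linorder_not_le)
      then show ?thesis using L by (simp add: dist_real_def right_diff_distrib linear_diff [OF L(1)])
    qed
    then show "\<exists>n. \<forall>k\<ge>n. \<forall>m\<ge>n. dist (L (f * Q k)) (L (f * Q m)) < e" by blast
  qed
  define M where "M f = lim (\<lambda>k. L (f * Q k))" for f
  have M: "(\<lambda>k. L (f * Q k)) \<longlonglongrightarrow> M f" for f
    using conv by (simp add: M_def convergent_LIMSEQ_iff)
  have "linear M"
  proof
    fix f g
    have "(\<lambda>k. L (f * Q k) + L (g * Q k)) \<longlonglongrightarrow> M (f + g)"
      using M [of "f + g"] L by (simp add: distrib_right linear_add [OF L(1)])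
    then show "M (f + g) = M f + M g"
      using tendsto_add [OF M M] LIMSEQ_unique by blast
  next
    fix r f
    have "(\<lambda>k. r * L (f * Q k)) \<longlonglongrightarrow> M (r *\<^sub>R f)"
      using M [of "r *\<^sub>R f"] L by (simp add: scaleR_eq_Const_mult mult.assoc linear_Const_mult [OF L(1)])
    then show "M (r *\<^sub>R f) = r *\<^sub>R M f"
      using LIMSEQ_unique [OF _ tendsto_mult_left [OF M, of r f]] by simp
  qed
  have "psd M"
    unfolding psd_def
  proof
    fix f
    have "0 \<le> L (f\<^sup>2 * Q k)" for k
    proof -
      obtain a b where "Q k = a\<^sup>2 + b\<^sup>2" using sos by blast
      then have "f\<^sup>2 * Q k = (f * a)\<^sup>2 + (f * b)\<^sup>2"
        by (simp add: algebra_simps power2_eq_square)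
      then show ?thesis using L by (simp add: linear_add [OF L(1)] psd_def)
    qed
    then show "0 \<le> M (f\<^sup>2)" by (intro LIMSEQ_le_const [OF M]) auto
  qed
  \<comment> \<open>By Cauchy-Schwarz, \<open>L (f * (1 - p * Q k))\<close> tends to 0, and hence
    \<open>L (p * f * Q k)\<close> tends to \<open>L f\<close>.\<close>
  have M_p: "M (p * f) = L f" for f
  proof -
    have "(\<lambda>k. (L (f * (1 - p * Q k)))\<^sup>2) \<longlonglongrightarrow> 0"
    proof (rule tendsto_sandwich [OF _ _ tendsto_const])
      show "(\<lambda>k. L (f\<^sup>2) * L ((1 - p * Q k)\<^sup>2)) \<longlonglongrightarrow> 0"
        using tendsto_mult_left [OF lim] by simp
    qed (auto intro!: always_eventually psd_Cauchy_Schwarz [OF L])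
    then have "(\<lambda>k. L (f * (1 - p * Q k))) \<longlonglongrightarrow> 0"
      by (simp add: tendsto_null_power)
    then have "(\<lambda>k. L f - L (p * f * Q k)) \<longlonglongrightarrow> 0"
      by (simp add: right_diff_distrib linear_diff [OF L(1)] mult_ac)
    moreover have "(\<lambda>k. L f - L (p * f * Q k)) \<longlonglongrightarrow> L f - M (p * f)"
      by (intro tendsto_intros M)
    ultimately have "0 = L f - M (p * f)" by (rule LIMSEQ_unique)
    then show ?thesis by simp
  qed
  \<comment> \<open>\<open>M\<close> takes the value \<open>L (g^2)\<close> at
    \<open>p * g^2\<close>, which exceeds \<open>g^2\<close> by a square.\<close>
  have "M (g\<^sup>2) \<le> L (g\<^sup>2)" for g
  proof -
    have "p * g\<^sup>2 = g\<^sup>2 + (X j * g)\<^sup>2"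
      by (simp add: p_def algebra_simps power2_eq_square)
    then show ?thesis
      using psd_add_sq [OF \<open>linear M\<close> \<open>psd M\<close>, of g "X j * g"] M_p [of "g\<^sup>2"] by simp
  qed
  then show thesis
    using that \<open>linear M\<close> \<open>psd M\<close> M_p unfolding p_def by blast
qed

text \<open>One variable is localized after another. Domination by \<open>L\<close> on squares is
  carried along because it keeps the remaining variables localizable.\<close>

lemma localize_finite:
  fixes L :: "('n, real) mpoly \<Rightarrow> real"
  assumes "finite S" "linear L" "psd L" "\<And>j. j \<in> S \<Longrightarrow> localizable L j"
  shows "\<exists>M. linear M \<and> psd M \<and> (\<forall>f. M ((\<Prod>j\<in>S. 1 + (X j)\<^sup>2) * f) = L f) \<and>
    (\<forall>g. M (g\<^sup>2) \<le> L (g\<^sup>2))"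
  using assms
proof (induction S rule: finite_induct)
  case empty
  then show ?case by auto
next
  case (insert i S)
  then obtain M where M: "linear M" "psd M" "\<And>f. M ((\<Prod>j\<in>S. 1 + (X j)\<^sup>2) * f) = L f"
      "\<And>g. M (g\<^sup>2) \<le> L (g\<^sup>2)"
    by fastforce
  have "localizable M i" using localizable_mono [of L i M] M insert.prems by blast
  then obtain K where K: "linear K" "psd K" "\<And>f. K ((1 + (X i)\<^sup>2) * f) = M f"
      "\<And>g. K (g\<^sup>2) \<le> M (g\<^sup>2)"
    using localize M by metis
  have "K ((\<Prod>j\<in>insert i S. 1 + (X j)\<^sup>2) * f) = L f" for f
    using insert.hyps by (simp add: mult.assoc K M)
  then show ?case using K M by (meson order_trans)
qed

text \<open>\<open>M f\<close> plays the role of \<open>L\<close> applied to \<open>f\<close> over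
  the product of the \<open>(1 + (X j)^2) ^ r\<close>; each step of the induction divides by every
  factor once.\<close>

lemma localize_power:
  fixes L :: "('n, real) mpoly \<Rightarrow> real"
  assumes "finite S" "linear L" "psd L" "\<And>j. j \<in> S \<Longrightarrow> localizable L j"
  shows "\<exists>M. linear M \<and> psd M \<and> (\<forall>f. M ((\<Prod>j\<in>S. (1 + (X j)\<^sup>2) ^ r) * f) = L f)"
  using assms
proof (induction r arbitrary: L)
  case 0
  then show ?case by auto
next
  case (Suc r)
  obtain M where M: "linear M" "psd M" "\<And>f. M ((\<Prod>j\<in>S. 1 + (X j)\<^sup>2) * f) = L f"
      "\<And>g. M (g\<^sup>2) \<le> L (g\<^sup>2)"
    using localize_finite [OF Suc.prems] by blast
  have "localizable M j" if "j \<in> S" for j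
    using Suc.prems(4) [OF that] M(2,4) by (rule localizable_mono)
  then obtain K where K: "linear K" "psd K" "\<And>f. K ((\<Prod>j\<in>S. (1 + (X j)\<^sup>2) ^ r) * f) = M f"
    using Suc.IH [OF \<open>finite S\<close> M(1,2)] by metis
  have "K ((\<Prod>j\<in>S. (1 + (X j)\<^sup>2) ^ Suc r) * f) = L f" for f
    unfolding power_Suc2 prod.distrib mult.assoc by (simp add: K M)
  then show ?case using K by blast
qed

section \<open>Univariate truncated moments\<close>

lemma map_poly_add_hom:
  assumes "h 0 = 0" "\<And>a b. h (a + b) = h a + h b"
  shows "map_poly h (p + q) = map_poly h p + map_poly h q"
  using assms by (intro poly_eqI) (simp add: coeff_map_poly)

lemma map_poly_mult_hom:
  fixes h :: "'a::comm_ring_1 \<Rightarrow> 'b::comm_ring_1"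
  assumes h: "h 0 = 0" "\<And>a b. h (a + b) = h a + h b" "\<And>a b. h (a * b) = h a * h b"
  shows "map_poly h (p * q) = map_poly h p * map_poly h q"
proof (induction p)
  case 0
  then show ?case by simp
next
  case (pCons a p)
  then show ?case
    by (simp add: map_poly_add_hom h map_poly_pCons map_poly_smult)
qed

lemma map_poly_of_real_mult:
  "map_poly of_real (p * q) = (map_poly of_real p * map_poly of_real q :: complex poly)"
  by (rule map_poly_mult_hom) auto

lemma poly_map_poly_of_real: "poly (map_poly of_real p) (of_real x) = (of_real (poly p x) :: complex)"
  by (induction p) (simp_all add: map_poly_pCons)

text \<open>Holds by continuity. Cancelling a factor that vanishes at \<open>c\<close> gives the
  sign of the quotient only away from \<open>c\<close>.\<close>

lemma nonneg_off_point:
  fixes p :: "real poly"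
  assumes "\<And>x. x \<noteq> c \<Longrightarrow> 0 \<le> poly p x"
  shows "0 \<le> poly p c"
proof (rule tendsto_lowerbound)
  show "(poly p \<longlongrightarrow> poly p c) (at c)"
    using poly_isCont [of c p] by (simp add: isCont_def)
  show "\<forall>\<^sub>F x in at c. 0 \<le> poly p x"
    using assms by (auto simp: eventually_at intro: exI [of _ 1])
qed simp

text \<open>This is multiplicativity of the norm for \<open>a + i b\<close> and
  \<open>c + i d\<close>.\<close>

lemma two_squares_mult: "(a\<^sup>2 + b\<^sup>2) * (c\<^sup>2 + d\<^sup>2) = (a * c - b * d)\<^sup>2 + (a * d + b * c)\<^sup>2"
  for a :: "'a::comm_ring_1"
  by (simp add: power2_eq_square algebra_simps)

text \<open>Induction on the degree by splitting off a complex root \<open>z\<close>. A real root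
  has even order, which yields the factor \<open>(x - z)^2\<close>; a nonreal one yields
  \<open>(x - Re z)^2 + (Im z)^2\<close>. Either factor is a sum of two squares with a nonnegative
  cofactor, and such sums are closed under products.\<close>

lemma nonneg_poly_two_squares:
  fixes p :: "real poly"
  assumes "\<And>x. 0 \<le> poly p x"
  shows "\<exists>a b. p = a\<^sup>2 + b\<^sup>2"
  using assms
proof (induction "degree p" arbitrary: p rule: less_induct)
  case less
  show ?case
  proof (cases "degree p = 0")
    case True
    then obtain c where c: "p = [:c:]" by (metis degree_eq_zeroE)
    then have "c \<ge> 0" using less.prems [of 0] by simp
    then have "p = [:sqrt c:]\<^sup>2 + 0\<^sup>2" using c by (simp add: power2_eq_square)
    then show ?thesis by blast
  next
    case False
    have step: "\<exists>a b. p = a\<^sup>2 + b\<^sup>2"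
      if fact: "p = (u\<^sup>2 + v\<^sup>2) * q" and deg: "degree (u\<^sup>2 + v\<^sup>2) > 0"
        and nonneg: "\<And>x. 0 \<le> poly q x" for u v q
    proof -
      have "q \<noteq> 0" using False fact by auto
      moreover have "u\<^sup>2 + v\<^sup>2 \<noteq> 0" using deg by auto
      ultimately have "degree p = degree (u\<^sup>2 + v\<^sup>2) + degree q"
        by (simp add: fact degree_mult_eq)
      with deg have "degree q < degree p" by simp
      from less.hyps [OF this nonneg] show ?thesis
        using fact two_squares_mult [of u v] by metis
    qed
    have "degree (map_poly complex_of_real p) \<noteq> 0"
      using False by (simp add: degree_map_poly)
    then have "\<not> constant (poly (map_poly complex_of_real p))"
      by (simp add: constant_degree)
    then obtain z where z: "poly (map_poly complex_of_real p) z = 0"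
      using fundamental_theorem_of_algebra by blast
    show ?thesis
    proof (cases "Im z = 0")
      case True
      define c where "c = Re z"
      have "z = of_real c" using True by (simp add: c_def complex_eq_iff)
      with z have "poly p c = 0" by (simp add: poly_map_poly_of_real)
      then obtain p1 where p1: "p = [:- c, 1:] * p1" by (auto simp: poly_eq_0_iff_dvd)
      have sgn: "0 \<le> (x - c) * poly p1 x" for x
        using less.prems [of x] by (simp add: p1 algebra_simps)
      \<comment> \<open>\<open>p1\<close> is nonnegative to the right of \<open>c\<close> and
        nonpositive to the left, so both one-sided limits force a zero.\<close>
      have "poly p1 c = 0"
      proof (rule antisym)
        have "(poly p1 \<longlongrightarrow> poly p1 c) (at c)"
          using poly_isCont [of c p1] by (simp add: isCont_def)
        then have lim: "(poly p1 \<longlongrightarrow> poly p1 c) (at_left c)" "(poly p1 \<longlongrightarrow> poly p1 c) (at_right c)"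
          by (simp_all add: filterlim_at_split)
        show "0 \<le> poly p1 c"
        proof (rule tendsto_lowerbound [OF lim(2)])
          show "\<forall>\<^sub>F x in at_right c. 0 \<le> poly p1 x"
            using sgn by (auto simp: eventually_at_filter zero_le_mult_iff intro!: always_eventually)
               (smt (verit) sgn)
        qed simp
        show "poly p1 c \<le> 0"
        proof (rule tendsto_upperbound [OF lim(1)])
          show "\<forall>\<^sub>F x in at_left c. poly p1 x \<le> 0"
            using sgn by (auto simp: eventually_at_filter zero_le_mult_iff intro!: always_eventually)
               (smt (verit) sgn)
        qed simp
      qed
      then obtain p2 where p2: "p1 = [:- c, 1:] * p2" by (auto simp: poly_eq_0_iff_dvd)
      have off: "0 \<le> poly p2 x" if "x \<noteq> c" for x
      proof -
        have "0 \<le> (x - c)\<^sup>2 * poly p2 x"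
          using less.prems [of x] by (simp add: p1 p2 power2_eq_square algebra_simps)
        then show ?thesis using that by (simp add: zero_le_mult_iff)
      qed
      show ?thesis
      proof (rule step)
        show "p = ([:- c, 1:]\<^sup>2 + 0\<^sup>2) * p2"
          unfolding p1 p2 by (simp only: power2_eq_square mult.assoc mult_zero_left add_0_right)
        show "0 < degree ([:- c, 1:]\<^sup>2 + 0\<^sup>2)"
          by (simp add: power2_eq_square)
        show "0 \<le> poly p2 x" for x
          using off nonneg_off_point [of c p2] by (cases "x = c") auto
      qed
    next
      case False
      define u v where "u = [:- Re z, 1:]" and "v = [:Im z:]"
      have uv: "u\<^sup>2 + v\<^sup>2 = [:(Re z)\<^sup>2 + (Im z)\<^sup>2, - 2 * Re z, 1:]"
        by (simp add: u_def v_def power2_eq_square)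
      \<comment> \<open>The remainder is a real polynomial of degree at most 1 that vanishes at the
        nonreal \<open>z\<close>, so it is 0.\<close>
      define r where "r = p mod (u\<^sup>2 + v\<^sup>2)"
      have deg2: "degree (u\<^sup>2 + v\<^sup>2) = 2" by (simp add: uv)
      then have "u\<^sup>2 + v\<^sup>2 \<noteq> 0" by auto
      then have "degree r < 2 \<or> r = 0"
        using degree_mod_less [of "u\<^sup>2 + v\<^sup>2" p] deg2 unfolding r_def by auto
      then have "coeff r n = 0" if "n \<ge> 2" for n
        using that by (auto intro: coeff_eq_0)
      then have r: "r = [:coeff r 0, coeff r 1:]"
        by (intro poly_eqI) (auto simp: coeff_pCons split: nat.splits)
      have "poly (map_poly complex_of_real (u\<^sup>2 + v\<^sup>2)) z = 0"
        unfolding uv by (simp add: map_poly_pCons complex_eq_iff power2_eq_square algebra_simps)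
      moreover have "p = (u\<^sup>2 + v\<^sup>2) * (p div (u\<^sup>2 + v\<^sup>2)) + r"
        by (simp add: r_def)
      then have "map_poly complex_of_real p = map_poly complex_of_real (u\<^sup>2 + v\<^sup>2)
          * map_poly complex_of_real (p div (u\<^sup>2 + v\<^sup>2)) + map_poly complex_of_real r"
        by (metis map_poly_of_real_mult map_poly_add_hom of_real_0 of_real_add)
      ultimately have "poly (map_poly complex_of_real r) z = 0"
        using z by simp
      then have "of_real (coeff r 0) + z * of_real (coeff r 1) = 0"
        by (subst (asm) r) (simp add: map_poly_pCons)
      then have "coeff r 1 = 0" "coeff r 0 = 0"
        using False by (auto simp: complex_eq_iff)
      then have "r = 0" using r by simp
      then have fact: "p = (u\<^sup>2 + v\<^sup>2) * (p div (u\<^sup>2 + v\<^sup>2))"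
        using \<open>p = _ + r\<close> by simp
      show ?thesis
      proof (rule step [OF fact])
        show "0 < degree (u\<^sup>2 + v\<^sup>2)" using deg2 by simp
        fix x
        have "(x - Re z)\<^sup>2 + (Im z)\<^sup>2 > 0" using False by (simp add: add_nonneg_pos)
        moreover have "poly p x = ((x - Re z)\<^sup>2 + (Im z)\<^sup>2) * poly (p div (u\<^sup>2 + v\<^sup>2)) x"
          by (subst fact) (simp add: u_def v_def)
        ultimately show "0 \<le> poly (p div (u\<^sup>2 + v\<^sup>2)) x"
          using less.prems [of x] by (simp add: zero_le_mult_iff)
      qed
    qed
  qed
qed

text \<open>Points close to minimising the distance to the moment vector almost satisfy the variational
  inequality of a projection onto a convex cone, so no minimiser is needed.\<close>

lemma truncated_moment_approximation:
  fixes \<Lambda> :: "real poly \<Rightarrow> real"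
  assumes add: "\<And>p q. \<Lambda> (p + q) = \<Lambda> p + \<Lambda> q" and smult: "\<And>c p. \<Lambda> (smult c p) = c * \<Lambda> p"
    and sq: "\<And>p. 0 \<le> \<Lambda> (p\<^sup>2)" and "\<epsilon> > 0"
  obtains xs :: "(real \<times> real) list"
  where "\<And>w t. (w, t) \<in> set xs \<Longrightarrow> 0 \<le> w"
    and "\<And>i. i \<le> D \<Longrightarrow> \<bar>(\<Sum>(w, t)\<leftarrow>xs. w * t ^ i) - \<Lambda> (monom 1 i)\<bar> < \<epsilon>"
proof -
  define mom where "mom xs i = (\<Sum>(w, t)\<leftarrow>xs. w * t ^ i)" for xs :: "(real \<times> real) list" and i
  \<comment> \<open>\<open>S\<close> stands for the cone of finitely atomic measures, given as lists
    of pairs of a weight and a point; \<open>d\<close> is the squared distance of their moments up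
    to degree \<open>D\<close> from those of \<open>\<Lambda>\<close>.\<close>
  define S where "S = {xs :: (real \<times> real) list. \<forall>(w, t)\<in>set xs. 0 \<le> w}"
  define l where "l i = \<Lambda> (monom 1 i)" for i
  define d where "d xs = (\<Sum>i\<le>D. (l i - mom xs i)\<^sup>2)" for xs
  define \<delta> where "\<delta> = (INF xs\<in>S. d xs)"
  have d_nonneg: "0 \<le> d xs" for xs by (simp add: d_def sum_nonneg)
  have "[] \<in> S" by (simp add: S_def)
  have bdd: "bdd_below (d ` S)" by (rule bdd_belowI2 [of _ 0]) (simp add: d_nonneg)
  have \<delta>_le: "\<delta> \<le> d xs" if "xs \<in> S" for xs
    unfolding \<delta>_def using bdd that by (rule cINF_lower)
  have near: "\<exists>xs\<in>S. d xs < \<delta> + e" if "e > 0" for e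
    using that cINF_less_iff [OF _ bdd, of "\<delta> + e"] \<open>[] \<in> S\<close> by (auto simp: \<delta>_def)
  have \<Lambda>_0: "\<Lambda> 0 = 0" using smult [of 0 0] by simp
  have \<Lambda>_sum: "\<Lambda> (\<Sum>i\<in>A. f i) = (\<Sum>i\<in>A. \<Lambda> (f i))" for A :: "nat set" and f
    by (induction A rule: infinite_finite_induct) (simp_all add: add \<Lambda>_0)
  have \<Lambda>_nonneg: "0 \<le> \<Lambda> p" if "\<And>x. 0 \<le> poly p x" for p
    using nonneg_poly_two_squares [OF that] add sq by fastforce
  define C where "C = \<Lambda> 1 + (\<Sum>i\<le>D. \<Lambda> (monom 1 (2 * i)))"
  define K where "K = C + 1 + 2 * (\<Sum>i\<le>D. (l i)\<^sup>2) + 2 * (\<delta> + 1)"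
  \<comment> \<open>A list within \<open>\<eta>^2\<close> of the infimum is compared with two
    perturbations of itself: an added atom of mass \<open>\<eta>\<close>, and all masses scaled by
    \<open>1 - \<eta>\<close>. The two inequalities add up to a bound on \<open>2 * d xs\<close>,
    whose constants \<open>K\<close> collects.\<close>
  have bound: "2 * \<delta> \<le> \<eta> * K" if \<eta>: "0 < \<eta>" "\<eta> \<le> 1" for \<eta>
  proof -
    obtain xs where xs: "xs \<in> S" and d_xs: "d xs < \<delta> + \<eta>\<^sup>2"
      using near [of "\<eta>\<^sup>2"] \<eta> by auto
    define m where "m i = mom xs i" for i
    define r where "r i = l i - m i" for i
    have d_eq: "d xs = (\<Sum>i\<le>D. (r i)\<^sup>2)" by (simp add: d_def r_def m_def)
    have "2 * (\<Sum>i\<le>D. r i * l i) \<le> \<eta> * C"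
    proof -
      \<comment> \<open>The test with an atom at \<open>t\<close> says that \<open>P\<close> is
        nonnegative at \<open>t\<close>. Applying \<open>\<Lambda>\<close> to \<open>P\<close>
        replaces each power of \<open>t\<close> by the value of \<open>\<Lambda>\<close> on that
        monomial.\<close>
      define P where "P = smult \<eta> (1 + (\<Sum>i\<le>D. monom 1 (2 * i))) + (\<Sum>i\<le>D. smult (- 2 * r i) (monom 1 i))"
      have "0 \<le> poly P t" for t
      proof -
        have "(\<eta>, t) # xs \<in> S" using xs \<eta> by (auto simp: S_def)
        then have "\<delta> \<le> d ((\<eta>, t) # xs)" by (rule \<delta>_le)
        also have "\<dots> = (\<Sum>i\<le>D. (r i)\<^sup>2 + (- 2 * \<eta> * (r i * t ^ i) + \<eta>\<^sup>2 * t ^ (2 * i)))"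
          unfolding d_def by (rule sum.cong)
            (auto simp: r_def m_def mom_def power2_eq_square algebra_simps power_mult power_even_eq)
        also have "\<dots> = d xs + (- 2 * \<eta> * (\<Sum>i\<le>D. r i * t ^ i) + \<eta>\<^sup>2 * (\<Sum>i\<le>D. t ^ (2 * i)))"
          by (simp add: d_eq sum.distrib sum_distrib_left sum_subtractf sum_negf)
        finally have "0 \<le> \<eta> * (\<eta> * (1 + (\<Sum>i\<le>D. t ^ (2 * i))) - 2 * (\<Sum>i\<le>D. r i * t ^ i))"
          using d_xs by (simp add: algebra_simps power2_eq_square)
        then have "0 \<le> \<eta> * (1 + (\<Sum>i\<le>D. t ^ (2 * i))) - 2 * (\<Sum>i\<le>D. r i * t ^ i)"
          using \<eta> by (simp add: zero_le_mult_iff)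
        also have "\<dots> = poly P t"
          by (simp add: P_def poly_sum poly_monom sum_distrib_left sum_negf mult.assoc)
        finally show ?thesis .
      qed
      then have "0 \<le> \<Lambda> P" by (rule \<Lambda>_nonneg)
      then show ?thesis
        by (simp only: P_def add smult \<Lambda>_sum) (simp add: C_def l_def sum_distrib_left sum_negf mult.assoc)
    qed
    moreover have "- 2 * (\<Sum>i\<le>D. r i * m i) \<le> \<eta> * (1 + (\<Sum>i\<le>D. (m i)\<^sup>2))"
    proof -
      define ys where "ys = map (\<lambda>(w, t). ((1 - \<eta>) * w, t)) xs"
      have "ys \<in> S" using xs \<eta> by (auto simp: S_def ys_def)
      have mom_ys: "mom ys i = (1 - \<eta>) * m i" for i
        unfolding m_def mom_def ys_def sum_list_const_mult [symmetric]
        by (simp add: comp_def case_prod_beta mult.assoc)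
      have "\<delta> \<le> d ys" using \<open>ys \<in> S\<close> by (rule \<delta>_le)
      also have "\<dots> = (\<Sum>i\<le>D. (r i)\<^sup>2 + (2 * \<eta> * (r i * m i) + \<eta>\<^sup>2 * (m i)\<^sup>2))"
        unfolding d_def by (rule sum.cong)
          (auto simp: r_def mom_ys power2_eq_square algebra_simps)
      also have "\<dots> = d xs + (2 * \<eta> * (\<Sum>i\<le>D. r i * m i) + \<eta>\<^sup>2 * (\<Sum>i\<le>D. (m i)\<^sup>2))"
        by (simp add: d_eq sum.distrib sum_distrib_left)
      finally have "0 \<le> \<eta> * (\<eta> * (1 + (\<Sum>i\<le>D. (m i)\<^sup>2)) + 2 * (\<Sum>i\<le>D. r i * m i))"
        using d_xs by (simp add: algebra_simps power2_eq_square)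
      then show ?thesis using \<eta> by (simp add: zero_le_mult_iff)
    qed
    moreover have "(\<Sum>i\<le>D. (m i)\<^sup>2) \<le> 2 * (\<Sum>i\<le>D. (l i)\<^sup>2) + 2 * (\<delta> + 1)"
    proof -
      have "(m i)\<^sup>2 \<le> 2 * (l i)\<^sup>2 + 2 * (r i)\<^sup>2" for i
        using zero_le_power2 [of "l i + r i"] by (simp add: r_def power2_eq_square algebra_simps)
      then have "(\<Sum>i\<le>D. (m i)\<^sup>2) \<le> (\<Sum>i\<le>D. 2 * (l i)\<^sup>2 + 2 * (r i)\<^sup>2)"
        by (rule sum_mono)
      also have "\<dots> = 2 * (\<Sum>i\<le>D. (l i)\<^sup>2) + 2 * d xs"
        by (simp add: d_eq sum.distrib sum_distrib_left)
      finally show ?thesis using d_xs \<eta> power_le_one [of \<eta> 2] by simp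
    qed
    then have "\<eta> * (1 + (\<Sum>i\<le>D. (m i)\<^sup>2)) \<le> \<eta> * (1 + (2 * (\<Sum>i\<le>D. (l i)\<^sup>2) + 2 * (\<delta> + 1)))"
      using \<eta> by simp
    moreover have "2 * d xs = 2 * (\<Sum>i\<le>D. r i * l i) - 2 * (\<Sum>i\<le>D. r i * m i)"
      unfolding d_eq right_diff_distrib [symmetric] sum_subtractf [symmetric]
      by (simp add: r_def power2_eq_square)
    ultimately show ?thesis
      using \<delta>_le [OF xs] by (simp add: K_def algebra_simps)
  qed
  have "\<delta> \<le> 0"
  proof (rule ccontr)
    assume "\<not> \<delta> \<le> 0"
    then have "0 < \<delta>" by simp
    \<comment> \<open>So small that \<open>\<eta> * K \<le> \<delta>\<close>, against
      \<open>2 * \<delta> \<le> \<eta> * K\<close>.\<close>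
    define \<eta> where "\<eta> = min 1 (\<delta> / (\<bar>K\<bar> + 1))"
    have \<eta>: "0 < \<eta>" "\<eta> \<le> 1" using \<open>0 < \<delta>\<close> by (auto simp: \<eta>_def)
    have "\<eta> * K \<le> \<eta> * (\<bar>K\<bar> + 1)"
      using \<eta> by (intro mult_left_mono) auto
    also have "\<dots> \<le> \<delta> / (\<bar>K\<bar> + 1) * (\<bar>K\<bar> + 1)"
      by (intro mult_right_mono) (auto simp: \<eta>_def)
    also have "\<dots> = \<delta>" by simp
    finally show False using bound [OF \<eta>] \<open>0 < \<delta>\<close> by simp
  qed
  then obtain xs where xs: "xs \<in> S" "d xs < \<epsilon>\<^sup>2"
    using near [of "\<epsilon>\<^sup>2"] \<open>\<epsilon> > 0\<close> by force
  show thesis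
  proof (rule that)
    show "0 \<le> w" if "(w, t) \<in> set xs" for w t using xs that by (auto simp: S_def)
    fix i assume "i \<le> D"
    then have "(l i - mom xs i)\<^sup>2 \<le> d xs"
      unfolding d_def by (intro member_le_sum) auto
    with xs have "\<bar>l i - mom xs i\<bar> < \<bar>\<epsilon>\<bar>" by (simp add: abs_le_square_iff flip: not_le)
    then show "\<bar>(\<Sum>(w, t)\<leftarrow>xs. w * t ^ i) - \<Lambda> (monom 1 i)\<bar> < \<epsilon>"
      using \<open>\<epsilon> > 0\<close> by (simp add: l_def mom_def abs_minus_commute)
  qed
qed

section \<open>Kernels of de la Vallee Poussin\<close>

text \<open>Neighbouring coefficients have the quotient \<open>(N - i) / (N + i + 1)\<close>, which
  tends to 1.\<close>

lemma central_binomial_ratio_shift: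
  "(\<lambda>N. real (2 * N choose (N + i)) / real (2 * N choose N)) \<longlonglongrightarrow> 1"
proof (induction i)
  case 0
  then show ?case by simp
next
  case (Suc i)
  have rec: "real (2 * N choose (N + Suc i))
      = real (2 * N choose (N + i)) * (real (N - i) / real (N + i + 1))" for N
  proof -
    have "Suc (N + i) * (2 * N choose Suc (N + i)) = (2 * N - (N + i)) * (2 * N choose (N + i))"
      using binomial_absorption [of "N + i" "2 * N"] binomial_absorb_comp [of "2 * N" "N + i"] by simp
    then have "real (Suc (N + i)) * real (2 * N choose Suc (N + i)) = real (N - i) * real (2 * N choose (N + i))"
      unfolding of_nat_mult [symmetric] by simp
    then show ?thesis by (simp add: field_simps)
  qed
  have "(\<lambda>N. (real N - real i) / (real N + real i + 1)) \<longlonglongrightarrow> 1"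
    by real_asymp
  moreover have "\<forall>\<^sub>F N in sequentially. (real N - real i) / (real N + real i + 1) = real (N - i) / real (N + i + 1)"
    using eventually_ge_at_top [of i] by eventually_elim (simp add: of_nat_diff)
  ultimately have "(\<lambda>N. real (N - i) / real (N + i + 1)) \<longlonglongrightarrow> 1"
    by (rule Lim_transform_eventually)
  from tendsto_mult [OF Suc.IH this] show ?case
    unfolding rec by (simp add: mult_ac)
qed

text \<open>For \<open>j > s\<close> the symmetry of binomial coefficients reflects the index to
  \<open>N + (j - s)\<close>. The natural subtraction is truncated only for finitely many
  \<open>N\<close>.\<close>

lemma central_binomial_ratio:
  "(\<lambda>N. real (2 * N choose (N + s - j)) / real (2 * N choose N)) \<longlonglongrightarrow> 1"
proof (cases "j \<le> s")
  case True
  then show ?thesis using central_binomial_ratio_shift [of "s - j"] by simp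
next
  case False
  have "\<forall>\<^sub>F N in sequentially. real (2 * N choose (N + (j - s))) / real (2 * N choose N)
      = real (2 * N choose (N + s - j)) / real (2 * N choose N)"
    using eventually_ge_at_top [of "j - s"]
  proof eventually_elim
    case (elim N)
    then have "2 * N choose (N + (j - s)) = 2 * N choose (2 * N - (N + (j - s)))"
      by (intro binomial_symmetric) simp
    also have "2 * N - (N + (j - s)) = N + s - j" using False by simp
    finally show ?case by simp
  qed
  with central_binomial_ratio_shift show ?thesis by (rule Lim_transform_eventually)
qed

lemma cis_fraction_eq_1:
  fixes d :: int and m :: nat
  assumes "cis (2 * pi * d / m) = 1" "\<bar>d\<bar> < m"
  shows "d = 0"
proof -
  have "cos (2 * pi * d / m) = 1" using assms(1) by (simp add: complex_eq_iff)
  then obtain n :: int where "2 * pi * d / m = real_of_int n * 2 * pi"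
    using cos_one_2pi_int by blast
  then have "real_of_int d = n * m" using assms(2) by (simp add: field_simps)
  then have "d = n * int m" by (metis of_int_eq_iff of_int_mult of_int_of_nat_eq)
  then show ?thesis using assms(2) by (auto simp: abs_mult)
qed

text \<open>The summands are the powers of \<open>cis (2 * pi * (A - M) / m)\<close>. As
  \<open>A - M\<close> is less than \<open>m\<close> in absolute value, this \<open>m\<close>-th
  root of unity differs from 1 unless \<open>A = M\<close>, and then its geometric sum
  vanishes.\<close>

lemma sum_cis_orthogonal:
  assumes "A + B = 2 * M" and m: "m = 2 * M + 1"
  shows "(\<Sum>k\<in>{..<m :: nat}. cis (pi * k / m) ^ A * cis (- (pi * k / m)) ^ B) = (if A = M then of_nat m else 0)"
proof -
  define d where "d = int A - int M"
  define z where "z = cis (2 * pi * d / m)"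
  have B: "real B = 2 * real M - real A" using assms by linarith
  have "cis (pi * k / m) ^ A * cis (- (pi * k / m)) ^ B = z ^ k" for k :: nat
  proof -
    have "cis (pi * k / m) ^ A * cis (- (pi * k / m)) ^ B
        = cis (A * (pi * k / m) + B * (- (pi * k / m)))"
      by (simp only: Complex.DeMoivre cis_mult)
    also have "A * (pi * k / m) + B * (- (pi * k / m)) = k * (2 * pi * d / m)"
      by (simp add: B d_def algebra_simps diff_divide_distrib add_divide_distrib)
    finally show ?thesis by (simp only: z_def Complex.DeMoivre)
  qed
  then have sum: "(\<Sum>k\<in>{..<m :: nat}. cis (pi * k / m) ^ A * cis (- (pi * k / m)) ^ B) = (\<Sum>k\<in>{..<m}. z ^ k)" by simp
  show ?thesis
  proof (cases "A = M")
    case True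
    then have "z = 1" by (simp add: z_def d_def)
    then show ?thesis using True sum by simp
  next
    case False
    have "\<bar>d\<bar> < int m" using assms by (simp add: d_def)
    then have "z \<noteq> 1" using cis_fraction_eq_1 [of d m] False by (auto simp: z_def d_def)
    moreover have "real m * (2 * pi * d / m) = 2 * pi * d" using m by simp
    then have "z ^ m = 1"
      by (simp only: z_def Complex.DeMoivre) (simp add: cis_multiple_2pi)
    ultimately show ?thesis using False sum geometric_sum [of z m] by simp
  qed
qed

text \<open>The functions \<open>x ^ a / (1 + x ^ 2) ^ s\<close> are trigonometric polynomials in twice the angle
  \<open>arctan x\<close>, and \<open>((1 + t * x) ^ 2 / ((1 + t ^ 2) * (1 + x ^ 2))) ^ N\<close> is the kernel of de la Vallee
  Poussin in that angle.  Equidistant nodes integrate the products that occur exactly, so that the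
  kernel acts on the Fourier coefficients through ratios of binomial coefficients.\<close>

lemma de_la_Vallee_Poussin_nodes:
  fixes s :: nat
  obtains r :: "nat \<Rightarrow> nat \<Rightarrow> nat \<Rightarrow> real"
  where "\<And>a i. a \<le> 2 * s \<Longrightarrow> (\<lambda>N. r N a i) \<longlonglongrightarrow> (if i = a then 1 else 0)"
    and "\<And>N. s \<le> N \<Longrightarrow> \<exists>m (t :: nat \<Rightarrow> real) \<omega>. (\<forall>k. 0 \<le> \<omega> k) \<and>
      (\<forall>a\<le>2 * s. \<forall>x. (\<Sum>k<m. \<omega> k * t k ^ a * (1 + t k * x) ^ (2 * N))
        = (1 + x\<^sup>2) ^ (N - s) * (\<Sum>i\<le>2 * s. r N a i * x ^ i))"
proof -
  \<comment> \<open>Dehomogenised form of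
    \<open>((w + v) / 2) ^ (2 * s - a) * ((w - v) / (2 * \<i>)) ^ a\<close>. At
    \<open>w = cis \<alpha>\<close> and \<open>v = cis (- \<alpha>)\<close> that expression is
    \<open>cos \<alpha> ^ (2 * s - a) * sin \<alpha> ^ a\<close>, so \<open>\<gamma> a\<close> lists
    Fourier coefficients.\<close>
  define G where "G a = [:1 / 2, 1 / 2:] ^ (2 * s - a) * [:- 1 / (2 * \<i>), 1 / (2 * \<i>):] ^ a" for a
  define \<gamma> where "\<gamma> a = coeff (G a)" for a
  \<comment> \<open>For \<open>x = tan \<alpha>\<close>, the quotient of \<open>e j\<close> by
    \<open>(1 + x^2) ^ s\<close> is the character \<open>cis (2 * (j - s) * \<alpha>)\<close>, and
    \<open>\<rho> N j\<close> is the factor by which the kernel multiplies it.\<close>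
  define e where "e j = [:1, \<i>:] ^ j * [:1, - \<i>:] ^ (2 * s - j)" for j
  define \<rho> where "\<rho> N j = real (2 * N choose (N + s - j)) / real (2 * N choose N)" for N j
  define r where "r N a i = Re (\<Sum>j\<le>2 * s. \<gamma> a j * \<rho> N j * coeff (e j) i)" for N a i
  have deg_e: "degree (e j) \<le> 2 * s" if "j \<le> 2 * s" for j
  proof -
    have "degree (e j) \<le> degree ([:1, \<i>:] ^ j) + degree ([:1, - \<i>:] ^ (2 * s - j))"
      unfolding e_def by (rule degree_mult_le)
    also have "\<dots> \<le> 1 * j + 1 * (2 * s - j)"
      by (intro add_mono order_trans [OF degree_power_le]) auto
    finally show ?thesis using that by simp
  qed
  have homog: "(\<Sum>j\<le>2 * s. \<gamma> a j * w ^ j * v ^ (2 * s - j)) = ((w + v) / 2) ^ (2 * s - a) * ((w - v) / (2 * \<i>)) ^ a"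
    if "v \<noteq> 0" and a: "a \<le> 2 * s" for a w v
  proof -
    have "degree (G a) \<le> degree ([:1 / 2, 1 / 2 :: complex:] ^ (2 * s - a)) + degree ([:- 1 / (2 * \<i>), 1 / (2 * \<i>):] ^ a)"
      unfolding G_def by (rule degree_mult_le)
    also have "\<dots> \<le> 1 * (2 * s - a) + 1 * a"
      by (intro add_mono order_trans [OF degree_power_le]) auto
    finally have deg: "degree (G a) \<le> 2 * s" using a by simp
    have "(\<Sum>j\<le>2 * s. \<gamma> a j * w ^ j * v ^ (2 * s - j)) = (\<Sum>j\<le>2 * s. v ^ (2 * s) * (\<gamma> a j * (w / v) ^ j))"
      using \<open>v \<noteq> 0\<close> by (intro sum.cong) (auto simp: power_divide power_diff)
    also have "\<dots> = v ^ (2 * s) * (\<Sum>j\<le>2 * s. \<gamma> a j * (w / v) ^ j)"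
      by (simp add: sum_distrib_left)
    also have "(\<Sum>j\<le>2 * s. \<gamma> a j * (w / v) ^ j) = poly (G a) (w / v)"
      unfolding \<gamma>_def poly_altdef using deg
      by (intro sum.mono_neutral_right) (auto simp: coeff_eq_0)
    also have "v ^ (2 * s) = v ^ (2 * s - a) * v ^ a"
      using a by (simp flip: power_add)
    also have "v ^ (2 * s - a) * v ^ a * poly (G a) (w / v)
        = (v * poly [:1 / 2, 1 / 2:] (w / v)) ^ (2 * s - a) * (v * poly [:- 1 / (2 * \<i>), 1 / (2 * \<i>):] (w / v)) ^ a"
      by (simp add: G_def power_mult_distrib)
    also have "v * poly [:1 / 2, 1 / 2:] (w / v) = (w + v) / 2"
      using \<open>v \<noteq> 0\<close> by (simp add: field_simps)
    also have "v * poly [:- 1 / (2 * \<i>), 1 / (2 * \<i>):] (w / v) = (w - v) / (2 * \<i>)"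
      using \<open>v \<noteq> 0\<close> by (simp add: field_simps)
    finally show ?thesis .
  qed
  \<comment> \<open>With \<open>w = 1 + \<i> * x\<close> and \<open>v = 1 - \<i> * x\<close>,
    \<open>homog\<close> expands \<open>x ^ a\<close>; as it holds for infinitely many
    \<open>x\<close>, it is an identity of polynomials.\<close>
  have coeff_e: "(\<Sum>j\<le>2 * s. \<gamma> a j * coeff (e j) i) = (if i = a then 1 else 0)" if a: "a \<le> 2 * s" for a i
  proof -
    define P where "P = (\<Sum>j\<le>2 * s. smult (\<gamma> a j) (e j)) - monom 1 a"
    have "poly P (of_real x) = 0" for x
    proof -
      have "1 - \<i> * of_real x \<noteq> 0" by (simp add: complex_eq_iff)
      from homog [OF this a, of "1 + \<i> * of_real x"] show ?thesis
        by (simp add: P_def e_def poly_sum poly_monom mult_ac)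
    qed
    then have "range complex_of_real \<subseteq> {x. poly P x = 0}" by auto
    moreover have "infinite (range complex_of_real)"
      by (simp add: finite_image_iff infinite_UNIV_char_0 inj_of_real)
    ultimately have "P = 0" using poly_roots_finite [of P] finite_subset by blast
    then have "coeff P i = 0" by simp
    then show ?thesis by (simp add: P_def coeff_sum split: if_splits)
  qed
  show thesis
  proof (rule that)
    fix a i assume a: "a \<le> 2 * s"
    have "(\<lambda>N. r N a i) \<longlonglongrightarrow> Re (\<Sum>j\<le>2 * s. \<gamma> a j * of_real 1 * coeff (e j) i)"
      unfolding r_def \<rho>_def by (intro tendsto_intros central_binomial_ratio)
    moreover have "Re (\<Sum>j\<le>2 * s. \<gamma> a j * of_real 1 * coeff (e j) i) = (if i = a then 1 else 0)"
      using coeff_e [OF a, of i] by (simp del: Re_sum)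
    ultimately show "(\<lambda>N. r N a i) \<longlonglongrightarrow> (if i = a then 1 else 0)" by simp
  next
    fix N assume N: "s \<le> N"
    \<comment> \<open>Oddness keeps the cosines at the nodes away from 0, and more than
      \<open>2 * (N + s)\<close> nodes make the quadrature exact.\<close>
    define m where "m = 2 * (N + s) + 1"
    define c S where "c k = cos (pi * k / m)" and "S k = sin (pi * k / m)" for k :: nat
    \<comment> \<open>\<open>Z\<close> normalises the kernel. The power of \<open>c k\<close> in the
      weight clears the denominators of \<open>t k ^ a * (1 + t k * x) ^ (2 * N)\<close>, where
      \<open>t k\<close> is the tangent of the node angle.\<close>
    define Z where "Z = real m * real (2 * N choose N) / 4 ^ N"
    define \<omega> where "\<omega> k = c k ^ (2 * (N + s)) / Z" for k
    define t where "t k = S k / c k" for k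
    have "Z > 0" by (simp add: Z_def m_def)
    have c_nz: "c k \<noteq> 0" for k
    proof
      assume "c k = 0"
      then obtain n :: int where "odd n" and n: "pi * k / m = n * (pi / 2)"
        unfolding c_def cos_zero_iff_int by blast
      have "real m > 0" by (simp add: m_def)
      with n have "pi * (2 * real k) = pi * (n * m)" by (simp add: field_simps)
      then have "2 * real k = n * m" by simp
      then have "2 * int k = n * int m" by (metis of_int_eq_iff of_int_mult of_int_numeral of_int_of_nat_eq)
      then have "even (n * int m)" by (metis dvd_triv_left)
      with \<open>odd n\<close> show False by (simp add: m_def)
    qed
    have main: "(\<Sum>k<m. \<omega> k * t k ^ a * (1 + t k * x) ^ (2 * N))
        = (1 + x\<^sup>2) ^ (N - s) * (\<Sum>i\<le>2 * s. r N a i * x ^ i)" if a: "a \<le> 2 * s" for a x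
    proof -
      define w v where "w = 1 + \<i> * of_real x" and "v = 1 - \<i> * of_real x"
      define E F where "E k = cis (pi * k / m)" and "F k = cis (- (pi * k / m))" for k :: nat
      have EF: "of_real (c k) = (E k + F k) / 2" "of_real (S k) = (E k - F k) / (2 * \<i>)"
        "of_real (c k + S k * x) = (E k * v + F k * w) / 2" for k
        by (simp_all add: E_def F_def c_def S_def v_def w_def complex_eq_iff Re_divide Im_divide)
      have F_nz: "F k \<noteq> 0" for k by (simp add: F_def)
      have wv: "w * v = of_real (1 + x\<^sup>2)"
        by (simp add: w_def v_def complex_eq_iff power2_eq_square)
      have term1: "of_real (c k ^ (2 * s - a) * S k ^ a) = (\<Sum>j\<le>2 * s. \<gamma> a j * E k ^ j * F k ^ (2 * s - j))" for k
        using homog [OF F_nz a] by (simp add: EF)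
      have term2: "of_real ((c k + S k * x) ^ (2 * N))
          = (\<Sum>l\<le>2 * N. of_nat (2 * N choose l) / 4 ^ N * (E k * v) ^ l * (F k * w) ^ (2 * N - l))" for k
      proof -
        have "(2 :: complex) ^ (2 * N) = 4 ^ N" by (simp add: power_mult)
        then have "((E k * v + F k * w) / 2) ^ (2 * N)
            = (\<Sum>l\<le>2 * N. of_nat (2 * N choose l) / 4 ^ N * (E k * v) ^ l * (F k * w) ^ (2 * N - l))"
          by (simp add: power_divide binomial_ring sum_divide_distrib)
        then show ?thesis by (simp only: of_real_power EF(3))
      qed
      have summand: "\<omega> k * t k ^ a * (1 + t k * x) ^ (2 * N)
          = (c k ^ (2 * s - a) * S k ^ a * (c k + S k * x) ^ (2 * N)) / Z" for k
      proof -
        have "1 + t k * x = (c k + S k * x) / c k" using c_nz by (simp add: t_def field_simps)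
        moreover have "c k ^ (2 * (N + s)) = c k ^ (2 * s - a) * c k ^ a * c k ^ (2 * N)"
          using a by (simp add: add.commute flip: power_add)
        ultimately show ?thesis
          using c_nz by (simp add: \<omega>_def t_def power_divide)
      qed
      \<comment> \<open>The two exponents add up to \<open>2 * (N + s)\<close>, so only
        \<open>j + l = N + s\<close> survives, and the double sum over \<open>j\<close> and
        \<open>l\<close> collapses to one over \<open>j\<close>.\<close>
      have orth: "(\<Sum>k<m. E k ^ (j + l) * F k ^ (2 * s - j + (2 * N - l))) = (if l = N + s - j then of_nat m else 0)"
        if "j \<le> 2 * s" "l \<le> 2 * N" for j l
        unfolding E_def F_def using that N
        by (subst sum_cis_orthogonal [where M = "N + s"]) (auto simp: m_def)
      have "of_real (\<Sum>k<m. c k ^ (2 * s - a) * S k ^ a * (c k + S k * x) ^ (2 * N))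
          = (\<Sum>k<m. (\<Sum>j\<le>2 * s. \<gamma> a j * E k ^ j * F k ^ (2 * s - j))
              * (\<Sum>l\<le>2 * N. of_nat (2 * N choose l) / 4 ^ N * (E k * v) ^ l * (F k * w) ^ (2 * N - l)))"
        unfolding of_real_sum by (simp only: of_real_mult [of "_ * _"] term1 term2)
      also have "\<dots> = (\<Sum>k<m. \<Sum>j\<le>2 * s. \<Sum>l\<le>2 * N. \<gamma> a j * (of_nat (2 * N choose l) / 4 ^ N)
              * v ^ l * w ^ (2 * N - l) * (E k ^ (j + l) * F k ^ (2 * s - j + (2 * N - l))))"
        unfolding sum_product power_mult_distrib power_add by (simp only: mult_ac)
      also have "\<dots> = (\<Sum>j\<le>2 * s. \<Sum>l\<le>2 * N. \<Sum>k<m. \<gamma> a j * (of_nat (2 * N choose l) / 4 ^ N)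
              * v ^ l * w ^ (2 * N - l) * (E k ^ (j + l) * F k ^ (2 * s - j + (2 * N - l))))"
        by (subst sum.swap) (intro sum.cong refl sum.swap)
      also have "\<dots> = (\<Sum>j\<le>2 * s. \<Sum>l\<le>2 * N. if l = N + s - j then
              \<gamma> a j * (of_nat (2 * N choose l) / 4 ^ N) * v ^ l * w ^ (2 * N - l) * of_nat m else 0)"
        unfolding sum_distrib_left [symmetric]
      proof (intro sum.cong refl)
        fix j l assume "j \<in> {..2 * s}" "l \<in> {..2 * N}"
        then show "\<gamma> a j * (of_nat (2 * N choose l) / 4 ^ N) * v ^ l * w ^ (2 * N - l)
              * (\<Sum>k<m. E k ^ (j + l) * F k ^ (2 * s - j + (2 * N - l)))
            = (if l = N + s - j then
              \<gamma> a j * (of_nat (2 * N choose l) / 4 ^ N) * v ^ l * w ^ (2 * N - l) * of_nat m else 0)"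
          by (subst orth) auto
      qed
      also have "\<dots> = (\<Sum>j\<le>2 * s. \<gamma> a j * (of_nat (2 * N choose (N + s - j)) / 4 ^ N)
              * v ^ (N + s - j) * w ^ (2 * N - (N + s - j)) * of_nat m)"
        using N by (intro sum.cong refl) (auto simp: sum.delta)
      also have "\<dots> = (\<Sum>j\<le>2 * s. of_real Z * (w * v) ^ (N - s) * (\<gamma> a j * \<rho> N j * (w ^ j * v ^ (2 * s - j))))"
      proof (rule sum.cong [OF refl])
        fix j assume j: "j \<in> {..2 * s}"
        have "v ^ (N + s - j) = v ^ (N - s) * v ^ (2 * s - j)" "w ^ (2 * N - (N + s - j)) = w ^ (N - s) * w ^ j"
          using j N by (simp_all add: add.commute [of N s] flip: power_add)
        then show "\<gamma> a j * (of_nat (2 * N choose (N + s - j)) / 4 ^ N)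
              * v ^ (N + s - j) * w ^ (2 * N - (N + s - j)) * of_nat m
            = of_real Z * (w * v) ^ (N - s) * (\<gamma> a j * \<rho> N j * (w ^ j * v ^ (2 * s - j)))"
          by (simp add: Z_def \<rho>_def power_mult_distrib)
      qed
      also have "\<dots> = of_real (Z * (1 + x\<^sup>2) ^ (N - s)) * (\<Sum>j\<le>2 * s. \<gamma> a j * \<rho> N j * (w ^ j * v ^ (2 * s - j)))"
        by (simp add: sum_distrib_left wv mult.assoc)
      also have "(\<Sum>j\<le>2 * s. \<gamma> a j * \<rho> N j * (w ^ j * v ^ (2 * s - j)))
          = (\<Sum>j\<le>2 * s. \<gamma> a j * \<rho> N j * (\<Sum>i\<le>2 * s. coeff (e j) i * of_real x ^ i))"
      proof (intro sum.cong refl arg_cong2 [where f = "(*)"])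
        fix j assume "j \<in> {..2 * s}"
        then have "poly (e j) (of_real x) = (\<Sum>i\<le>2 * s. coeff (e j) i * of_real x ^ i)"
          unfolding poly_altdef using deg_e [of j]
          by (intro sum.mono_neutral_left) (auto simp: coeff_eq_0)
        then show "w ^ j * v ^ (2 * s - j) = (\<Sum>i\<le>2 * s. coeff (e j) i * of_real x ^ i)"
          by (simp add: e_def w_def v_def mult.commute)
      qed
      also have "\<dots> = (\<Sum>i\<le>2 * s. (\<Sum>j\<le>2 * s. \<gamma> a j * \<rho> N j * coeff (e j) i) * of_real (x ^ i))"
        unfolding sum_distrib_left sum_distrib_right by (subst sum.swap) (simp add: mult.assoc)
      finally have "(\<Sum>k<m. c k ^ (2 * s - a) * S k ^ a * (c k + S k * x) ^ (2 * N))
          = Re (of_real (Z * (1 + x\<^sup>2) ^ (N - s)) * (\<Sum>i\<le>2 * s. (\<Sum>j\<le>2 * s. \<gamma> a j * \<rho> N j * coeff (e j) i) * of_real (x ^ i)))"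
        by (metis Re_complex_of_real)
      also have "\<dots> = Z * ((1 + x\<^sup>2) ^ (N - s) * (\<Sum>i\<le>2 * s. r N a i * x ^ i))"
      proof -
        have "Re (of_real y * z) = y * Re z" "Re (z * of_real y) = Re z * y" for y z by simp_all
        then show ?thesis by (simp only: r_def Re_sum mult.assoc)
      qed
      finally show ?thesis
        unfolding summand sum_divide_distrib [symmetric] using \<open>Z > 0\<close> by simp
    qed
    show "\<exists>m (t :: nat \<Rightarrow> real) \<omega>. (\<forall>k. 0 \<le> \<omega> k) \<and>
      (\<forall>a\<le>2 * s. \<forall>x. (\<Sum>k<m. \<omega> k * t k ^ a * (1 + t k * x) ^ (2 * N))
        = (1 + x\<^sup>2) ^ (N - s) * (\<Sum>i\<le>2 * s. r N a i * x ^ i))"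
    proof (intro exI conjI allI impI)
      show "0 \<le> \<omega> k" for k using \<open>Z > 0\<close> by (simp add: \<omega>_def zero_le_even_power)
    qed (rule main)
  qed
qed

section \<open>Atomic approximation\<close>

lemma map_poly_Const_hom:
  "map_poly Const (p + q) = (map_poly Const p + map_poly Const q :: ('n, real) mpoly poly)"
  "map_poly Const (p * q) = (map_poly Const p * map_poly Const q :: ('n, real) mpoly poly)"
  "map_poly Const (smult c p) = (smult (Const c) (map_poly Const p) :: ('n, real) mpoly poly)"
  by (simp_all add: map_poly_add_hom map_poly_mult_hom map_poly_smult Const_hom)

definition mpoly_of_poly :: "'n \<Rightarrow> real poly \<Rightarrow> ('n, real) mpoly"
  where "mpoly_of_poly j p = poly (map_poly Const p) (X j)"

lemma mpoly_of_poly_hom: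
  "mpoly_of_poly j (p + q) = mpoly_of_poly j p + mpoly_of_poly j q"
  "mpoly_of_poly j (p * q) = mpoly_of_poly j p * mpoly_of_poly j q"
  "mpoly_of_poly j (smult c p) = Const c * mpoly_of_poly j p"
  "mpoly_of_poly j 0 = 0" "mpoly_of_poly j 1 = 1"
  "mpoly_of_poly j [:c, d:] = Const c + Const d * X j"
  by (simp_all add: mpoly_of_poly_def map_poly_Const_hom Const_hom map_poly_pCons mult.commute)

lemma mpoly_of_poly_power: "mpoly_of_poly j (p ^ k) = mpoly_of_poly j p ^ k"
  by (induction k) (simp_all add: mpoly_of_poly_hom)

lemma mpoly_of_poly_sum: "mpoly_of_poly j (\<Sum>i\<in>A. f i) = (\<Sum>i\<in>A. mpoly_of_poly j (f i))"
  by (induction A rule: infinite_finite_induct) (simp_all add: mpoly_of_poly_hom)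

lemma mpoly_of_poly_monom: "mpoly_of_poly j (monom c i) = Const c * X j ^ i"
  by (simp add: mpoly_of_poly_def map_poly_monom Const_hom poly_monom)

lemma sum_list_concat_map_distinct:
  "distinct ks \<Longrightarrow> (\<Sum>y\<leftarrow>concat (map f ks). g y) = (\<Sum>k\<in>set ks. \<Sum>y\<leftarrow>f k. g y)"
  for g :: "'b \<Rightarrow> 'c::comm_monoid_add"
  by (induction ks) auto

text \<open>Separates the scalars from the values of \<open>L\<close> on products. Convergence of
  scalars then gives convergence of \<open>L\<close>, and sums over nodes become sums over choices
  of one node per variable.\<close>

lemma linear_prod_sum_expand:
  fixes L :: "('n, real) mpoly \<Rightarrow> real"
  assumes L: "linear L" and fin: "finite I" "\<And>j. j \<in> I \<Longrightarrow> finite (B j)"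
  shows "L ((\<Prod>j\<in>I. \<Sum>i\<in>B j. Const (c j i) * f j i) * g)
    = (\<Sum>\<iota>\<in>PiE I B. (\<Prod>j\<in>I. c j (\<iota> j)) * L ((\<Prod>j\<in>I. f j (\<iota> j)) * g))"
proof -
  have "(\<Prod>j\<in>I. \<Sum>i\<in>B j. Const (c j i) * f j i) * g
      = (\<Sum>\<iota>\<in>PiE I B. Const (\<Prod>j\<in>I. c j (\<iota> j)) * ((\<Prod>j\<in>I. f j (\<iota> j)) * g))"
    using fin by (simp add: prod_sum_PiE prod.distrib Const_prod sum_distrib_right mult.assoc)
  then show ?thesis by (simp add: linear_sum [OF L] linear_Const_mult [OF L])
qed

text \<open>Two approximations are composed. Smoothing by the kernels changes \<open>L\<close> on
  the finitely many monomials by less than \<open>\<epsilon> / 2\<close>; the smoothed value is a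
  finite sum, over choices \<open>\<kappa>\<close> of nodes, of functionals in \<open>X l\<close>
  alone, and replacing these by atoms costs at most another \<open>\<epsilon> / 2\<close>.\<close>

lemma psd_atomic_approximation:
  fixes L :: "('n::finite, real) mpoly \<Rightarrow> real"
  assumes L: "linear L" "psd L" and loc: "\<And>j. j \<noteq> l \<Longrightarrow> localizable L j" and "\<epsilon> > 0"
  obtains xs :: "((real ^ 'n) \<times> real) list"
  where "\<And>x w. (x, w) \<in> set xs \<Longrightarrow> 0 \<le> w"
    and "\<And>a. (\<And>j. a j \<le> 2 * s) \<Longrightarrow>
      \<bar>(\<Sum>(x, w)\<leftarrow>xs. w * (\<Prod>j\<in>UNIV. x $ j ^ a j)) - L (\<Prod>j\<in>UNIV. X j ^ a j)\<bar> < \<epsilon>"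
proof -
  define I where "I = UNIV - {l}"
  have split: "(\<Prod>j\<in>UNIV. f j) = f l * (\<Prod>j\<in>I. f j)" for f :: "'n \<Rightarrow> 'c::comm_monoid_mult"
    unfolding I_def by (rule prod.remove) auto
  obtain r where r_lim: "\<And>a i. a \<le> 2 * s \<Longrightarrow> (\<lambda>N. r N a i) \<longlonglongrightarrow> (if i = a then 1 else 0 :: real)"
    and r: "\<And>N. s \<le> N \<Longrightarrow> \<exists>m (t :: nat \<Rightarrow> real) \<omega>. (\<forall>k. 0 \<le> \<omega> k) \<and>
      (\<forall>a\<le>2 * s. \<forall>x. (\<Sum>k<m. \<omega> k * t k ^ a * (1 + t k * x) ^ (2 * N))
        = (1 + x\<^sup>2) ^ (N - s) * (\<Sum>i\<le>2 * s. r N a i * x ^ i))"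
    using de_la_Vallee_Poussin_nodes [of s] by blast
  \<comment> \<open>The monomial with exponents \<open>a\<close>, smoothed by the kernel in every
    variable other than \<open>l\<close>.\<close>
  define T where "T N a = (\<Prod>j\<in>I. \<Sum>i\<le>2 * s. Const (r N (a j) i) * X j ^ i) * X l ^ a l" for N and a :: "'n \<Rightarrow> nat"
  define A where "A = PiE (UNIV :: 'n set) (\<lambda>_. {..2 * s})"
  have "finite A" by (simp add: A_def finite_PiE)
  have lim: "(\<lambda>N. L (T N a)) \<longlonglongrightarrow> L (\<Prod>j\<in>UNIV. X j ^ a j)" if "a \<in> A" for a
  proof -
    have a: "a j \<le> 2 * s" for j using that by (auto simp: A_def)
    define \<delta> where "\<delta> j i = (if i = a j then 1 else 0 :: real)" for j i
    have "(\<Sum>i\<le>2 * s. Const (\<delta> j i) * X j ^ i) = (\<Sum>i\<le>2 * s. if i = a j then X j ^ i else (0 :: ('n, real) mpoly))" for j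
      by (intro sum.cong) (auto simp: \<delta>_def Const_hom)
    then have \<delta>: "(\<Sum>i\<le>2 * s. Const (\<delta> j i) * X j ^ i) = (X j ^ a j :: ('n, real) mpoly)" for j
      using a by simp
    have "(\<lambda>N. \<Sum>\<iota>\<in>PiE I (\<lambda>_. {..2 * s}). (\<Prod>j\<in>I. r N (a j) (\<iota> j)) * L ((\<Prod>j\<in>I. X j ^ \<iota> j) * X l ^ a l))
        \<longlonglongrightarrow> (\<Sum>\<iota>\<in>PiE I (\<lambda>_. {..2 * s}). (\<Prod>j\<in>I. \<delta> j (\<iota> j)) * L ((\<Prod>j\<in>I. X j ^ \<iota> j) * X l ^ a l))"
      unfolding \<delta>_def by (intro tendsto_intros r_lim a)
    also have "(\<lambda>N. \<Sum>\<iota>\<in>PiE I (\<lambda>_. {..2 * s}). (\<Prod>j\<in>I. r N (a j) (\<iota> j)) * L ((\<Prod>j\<in>I. X j ^ \<iota> j) * X l ^ a l))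
        = (\<lambda>N. L (T N a))"
      unfolding T_def by (subst linear_prod_sum_expand [OF L(1)]) (auto simp: I_def)
    also have "(\<Sum>\<iota>\<in>PiE I (\<lambda>_. {..2 * s}). (\<Prod>j\<in>I. \<delta> j (\<iota> j)) * L ((\<Prod>j\<in>I. X j ^ \<iota> j) * X l ^ a l))
        = L ((\<Prod>j\<in>I. \<Sum>i\<le>2 * s. Const (\<delta> j i) * X j ^ i) * X l ^ a l)"
      by (subst linear_prod_sum_expand [OF L(1)]) (auto simp: I_def)
    finally show ?thesis by (simp add: \<delta> split mult.commute [of "X l ^ a l"])
  qed
  have "\<forall>\<^sub>F N in sequentially. \<forall>a\<in>A. \<bar>L (T N a) - L (\<Prod>j\<in>UNIV. X j ^ a j)\<bar> < \<epsilon> / 2"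
  proof (intro eventually_ball_finite \<open>finite A\<close> ballI)
    fix a assume "a \<in> A"
    from tendstoD [OF lim [OF this], of "\<epsilon> / 2"] \<open>\<epsilon> > 0\<close>
    show "\<forall>\<^sub>F N in sequentially. \<bar>L (T N a) - L (\<Prod>j\<in>UNIV. X j ^ a j)\<bar> < \<epsilon> / 2"
      by (simp add: dist_real_def)
  qed
  then have "\<forall>\<^sub>F N in sequentially. s \<le> N \<and> (\<forall>a\<in>A. \<bar>L (T N a) - L (\<Prod>j\<in>UNIV. X j ^ a j)\<bar> < \<epsilon> / 2)"
    using eventually_ge_at_top by (rule eventually_conj [rotated])
  then obtain N where "s \<le> N" and N: "\<And>a. a \<in> A \<Longrightarrow> \<bar>L (T N a) - L (\<Prod>j\<in>UNIV. X j ^ a j)\<bar> < \<epsilon> / 2"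
    by (auto simp: eventually_sequentially)
  \<comment> \<open>The exponent \<open>N - s\<close> is that of \<open>1 + x^2\<close> in the node
    identity, so \<open>M\<close> cancels exactly this factor.\<close>
  obtain M where M: "linear M" "psd M" and M_L: "\<And>f. M ((\<Prod>j\<in>I. (1 + (X j)\<^sup>2) ^ (N - s)) * f) = L f"
    using localize_power [of I L "N - s"] L loc by (auto simp: I_def)
  obtain m and t \<omega> :: "nat \<Rightarrow> real" where \<omega>: "\<And>k. 0 \<le> \<omega> k"
    and nodes: "\<And>a x. a \<le> 2 * s \<Longrightarrow> (\<Sum>k<m. \<omega> k * t k ^ a * (1 + t k * x) ^ (2 * N))
        = (1 + x\<^sup>2) ^ (N - s) * (\<Sum>i\<le>2 * s. r N a i * x ^ i)"
    using r [OF \<open>s \<le> N\<close>] by blast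
  \<comment> \<open>The node identity holds at all real \<open>x\<close>, hence between univariate
    polynomials, into which \<open>X j\<close> can be substituted.\<close>
  have nodes_X: "(\<Sum>k<m. Const (\<omega> k * t k ^ a) * (1 + Const (t k) * X j) ^ (2 * N))
      = (1 + (X j)\<^sup>2) ^ (N - s) * (\<Sum>i\<le>2 * s. Const (r N a i) * X j ^ i)"
    if "a \<le> 2 * s" for a and j :: 'n
  proof -
    have "(\<Sum>k<m. smult (\<omega> k * t k ^ a) ([:1, t k:] ^ (2 * N)))
        = (1 + (monom 1 2)) ^ (N - s) * (\<Sum>i\<le>2 * s. monom (r N a i) i)"
      unfolding poly_eq_poly_eq_iff [symmetric]
      using nodes [OF that] by (simp add: fun_eq_iff poly_sum poly_monom mult.commute)
    from arg_cong [OF this, of "mpoly_of_poly j"] show ?thesis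
      by (simp add: mpoly_of_poly_hom mpoly_of_poly_sum mpoly_of_poly_power mpoly_of_poly_monom Const_hom(2))
  qed
  \<comment> \<open>\<open>(K \<kappa>)^2\<close> is the product of the kernel numerators at the
    nodes chosen by \<open>\<kappa>\<close>. Being a square, it makes
    \<open>\<Lambda> \<kappa>\<close> nonnegative on squares.\<close>
  define K where "K \<kappa> = (\<Prod>j\<in>I. (1 + Const (t (\<kappa> j)) * X j) ^ N)" for \<kappa> :: "'n \<Rightarrow> nat"
  define \<Lambda> where "\<Lambda> \<kappa> p = M ((K \<kappa>)\<^sup>2 * mpoly_of_poly l p)" for \<kappa> p
  define W where "W \<kappa> = (\<Prod>j\<in>I. \<omega> (\<kappa> j))" for \<kappa> :: "'n \<Rightarrow> nat"
  have W: "0 \<le> W \<kappa>" for \<kappa> by (simp add: W_def prod_nonneg \<omega>)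
  define S where "S = PiE I (\<lambda>_. {..<m})"
  have "finite S" by (simp add: S_def finite_PiE I_def)
  \<comment> \<open>Bounds the sum of the coefficients \<open>\<bar>v \<kappa>\<bar>\<close> for all
    exponents up to \<open>2 * s\<close> at once, so that the tolerance \<open>\<eta>\<close> and
    the atoms do not depend on \<open>a\<close>.\<close>
  define c where "c = (\<Sum>\<kappa>\<in>S. W \<kappa> * (\<Prod>j\<in>I. (1 + \<bar>t (\<kappa> j)\<bar>) ^ (2 * s)))"
  have "c \<ge> 0" unfolding c_def by (intro sum_nonneg mult_nonneg_nonneg W prod_nonneg) auto
  define \<eta> where "\<eta> = \<epsilon> / (2 * (c + 1))"
  have \<eta>: "\<eta> > 0" "c * \<eta> < \<epsilon> / 2"
    using \<open>\<epsilon> > 0\<close> \<open>c \<ge> 0\<close> by (simp_all add: \<eta>_def field_simps)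
  define approx where "approx \<kappa> ys \<longleftrightarrow> (\<forall>(w, \<tau>)\<in>set ys. 0 \<le> w) \<and>
      (\<forall>i\<le>2 * s. \<bar>(\<Sum>(w, \<tau>)\<leftarrow>ys. w * \<tau> ^ i) - \<Lambda> \<kappa> (monom 1 i)\<bar> < \<eta>)"
    for \<kappa> and ys :: "(real \<times> real) list"
  have "\<exists>ys. approx \<kappa> ys" for \<kappa>
  proof -
    have "\<Lambda> \<kappa> (p + q) = \<Lambda> \<kappa> p + \<Lambda> \<kappa> q" for p q
      by (simp add: \<Lambda>_def mpoly_of_poly_hom distrib_left linear_add [OF M(1)])
    moreover have "\<Lambda> \<kappa> (smult c p) = c * \<Lambda> \<kappa> p" for c p
      by (simp add: \<Lambda>_def mpoly_of_poly_hom mult.left_commute linear_Const_mult [OF M(1)])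
    moreover have "0 \<le> \<Lambda> \<kappa> (p\<^sup>2)" for p
      using M(2) by (simp add: \<Lambda>_def mpoly_of_poly_power psd_def flip: power_mult_distrib)
    ultimately obtain ys :: "(real \<times> real) list"
      where "\<And>w \<tau>. (w, \<tau>) \<in> set ys \<Longrightarrow> 0 \<le> w"
        and "\<And>i. i \<le> 2 * s \<Longrightarrow> \<bar>(\<Sum>(w, \<tau>)\<leftarrow>ys. w * \<tau> ^ i) - \<Lambda> \<kappa> (monom 1 i)\<bar> < \<eta>"
      using truncated_moment_approximation [of "\<Lambda> \<kappa>" \<eta> "2 * s"] \<eta>(1) by blast
    then show ?thesis by (intro exI [of _ ys]) (auto simp: approx_def)
  qed
  then obtain ys where "\<And>\<kappa>. approx \<kappa> (ys \<kappa>)"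
    by metis
  then have ys: "\<And>\<kappa> w \<tau>. (w, \<tau>) \<in> set (ys \<kappa>) \<Longrightarrow> 0 \<le> w"
    and ys_moment: "\<And>\<kappa> i. i \<le> 2 * s \<Longrightarrow> \<bar>(\<Sum>(w, \<tau>)\<leftarrow>ys \<kappa>. w * \<tau> ^ i) - \<Lambda> \<kappa> (monom 1 i)\<bar> < \<eta>"
    by (auto simp: approx_def)
  obtain \<kappa>s where \<kappa>s: "set \<kappa>s = S" "distinct \<kappa>s"
    using finite_distinct_list [OF \<open>finite S\<close>] by blast
  define pt where "pt \<kappa> \<tau> = (\<chi> j. if j = l then \<tau> else t (\<kappa> j))" for \<kappa> and \<tau> :: real
  define xs where "xs = concat (map (\<lambda>\<kappa>. map (\<lambda>(w, \<tau>). (pt \<kappa> \<tau>, W \<kappa> * w)) (ys \<kappa>)) \<kappa>s)"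
  show thesis
  proof (rule that [of xs])
    show "0 \<le> w" if "(x, w) \<in> set xs" for x w
      using that W by (auto simp: xs_def intro!: mult_nonneg_nonneg dest: ys)
    fix a :: "'n \<Rightarrow> nat" assume a: "\<And>j. a j \<le> 2 * s"
    then have "a \<in> A" by (auto simp: A_def)
    define v where "v \<kappa> = W \<kappa> * (\<Prod>j\<in>I. t (\<kappa> j) ^ a j)" for \<kappa>
    have "(\<Sum>(x, w)\<leftarrow>xs. w * (\<Prod>j\<in>UNIV. x $ j ^ a j))
        = (\<Sum>\<kappa>\<in>S. \<Sum>(w, \<tau>)\<leftarrow>ys \<kappa>. W \<kappa> * w * (\<Prod>j\<in>UNIV. pt \<kappa> \<tau> $ j ^ a j))"
      unfolding xs_def using \<kappa>s
      by (simp add: sum_list_concat_map_distinct comp_def case_prod_unfold)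
    also have "\<dots> = (\<Sum>\<kappa>\<in>S. v \<kappa> * (\<Sum>(w, \<tau>)\<leftarrow>ys \<kappa>. w * \<tau> ^ a l))"
    proof (intro sum.cong refl)
      fix \<kappa>
      have "(\<Prod>j\<in>I. pt \<kappa> \<tau> $ j ^ a j) = (\<Prod>j\<in>I. t (\<kappa> j) ^ a j)" for \<tau>
        by (intro prod.cong) (auto simp: pt_def I_def)
      then have "(\<Prod>j\<in>UNIV. pt \<kappa> \<tau> $ j ^ a j) = \<tau> ^ a l * (\<Prod>j\<in>I. t (\<kappa> j) ^ a j)" for \<tau>
        by (simp add: split pt_def)
      then show "(\<Sum>(w, \<tau>)\<leftarrow>ys \<kappa>. W \<kappa> * w * (\<Prod>j\<in>UNIV. pt \<kappa> \<tau> $ j ^ a j))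
          = v \<kappa> * (\<Sum>(w, \<tau>)\<leftarrow>ys \<kappa>. w * \<tau> ^ a l)"
        by (simp add: v_def sum_list_const_mult [symmetric] case_prod_unfold mult_ac)
    qed
    finally have atoms: "(\<Sum>(x, w)\<leftarrow>xs. w * (\<Prod>j\<in>UNIV. x $ j ^ a j))
        = (\<Sum>\<kappa>\<in>S. v \<kappa> * (\<Sum>(w, \<tau>)\<leftarrow>ys \<kappa>. w * \<tau> ^ a l))" .
    have "(\<Sum>\<kappa>\<in>S. v \<kappa> * \<Lambda> \<kappa> (monom 1 (a l)))
        = M ((\<Prod>j\<in>I. \<Sum>k<m. Const (\<omega> k * t k ^ a j) * (1 + Const (t k) * X j) ^ (2 * N)) * X l ^ a l)"
      unfolding S_def
    proof (subst linear_prod_sum_expand [OF M(1)])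
      show "(\<Sum>\<kappa>\<in>PiE I (\<lambda>_. {..<m}). v \<kappa> * \<Lambda> \<kappa> (monom 1 (a l)))
        = (\<Sum>\<kappa>\<in>PiE I (\<lambda>_. {..<m}). (\<Prod>j\<in>I. \<omega> (\<kappa> j) * t (\<kappa> j) ^ a j)
            * M ((\<Prod>j\<in>I. (1 + Const (t (\<kappa> j)) * X j) ^ (2 * N)) * X l ^ a l))"
        by (simp add: v_def W_def prod.distrib \<Lambda>_def K_def mpoly_of_poly_monom Const_hom(2)
            prod_power_distrib power_mult mult.commute [of 2 N])
    qed (auto simp: I_def)
    also have "\<dots> = M ((\<Prod>j\<in>I. (1 + (X j)\<^sup>2) ^ (N - s)) * T N a)"
      by (simp add: nodes_X [OF a] prod.distrib T_def mult.assoc)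
    also have "\<dots> = L (T N a)" by (rule M_L)
    finally have main: "(\<Sum>\<kappa>\<in>S. v \<kappa> * \<Lambda> \<kappa> (monom 1 (a l))) = L (T N a)" .
    have v_le: "\<bar>v \<kappa>\<bar> \<le> W \<kappa> * (\<Prod>j\<in>I. (1 + \<bar>t (\<kappa> j)\<bar>) ^ (2 * s))" for \<kappa>
    proof -
      have "\<bar>t (\<kappa> j) ^ a j\<bar> \<le> (1 + \<bar>t (\<kappa> j)\<bar>) ^ (2 * s)" for j
      proof -
        have "\<bar>t (\<kappa> j) ^ a j\<bar> \<le> (1 + \<bar>t (\<kappa> j)\<bar>) ^ a j"
          unfolding power_abs by (intro power_mono) auto
        also have "\<dots> \<le> (1 + \<bar>t (\<kappa> j)\<bar>) ^ (2 * s)"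
          using a by (intro power_increasing) auto
        finally show ?thesis .
      qed
      then have "(\<Prod>j\<in>I. \<bar>t (\<kappa> j) ^ a j\<bar>) \<le> (\<Prod>j\<in>I. (1 + \<bar>t (\<kappa> j)\<bar>) ^ (2 * s))"
        by (intro prod_mono) auto
      then show ?thesis
        unfolding v_def abs_mult abs_prod using W [of \<kappa>]
        by (intro mult_mono prod_nonneg) auto
    qed
    have "\<bar>(\<Sum>\<kappa>\<in>S. v \<kappa> * (\<Sum>(w, \<tau>)\<leftarrow>ys \<kappa>. w * \<tau> ^ a l)) - L (T N a)\<bar>
        = \<bar>\<Sum>\<kappa>\<in>S. v \<kappa> * ((\<Sum>(w, \<tau>)\<leftarrow>ys \<kappa>. w * \<tau> ^ a l) - \<Lambda> \<kappa> (monom 1 (a l)))\<bar>"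
      unfolding main [symmetric] by (simp add: sum_subtractf right_diff_distrib)
    also have "\<dots> \<le> (\<Sum>\<kappa>\<in>S. \<bar>v \<kappa> * ((\<Sum>(w, \<tau>)\<leftarrow>ys \<kappa>. w * \<tau> ^ a l) - \<Lambda> \<kappa> (monom 1 (a l)))\<bar>)"
      by (rule sum_abs)
    also have "\<dots> \<le> (\<Sum>\<kappa>\<in>S. W \<kappa> * (\<Prod>j\<in>I. (1 + \<bar>t (\<kappa> j)\<bar>) ^ (2 * s)) * \<eta>)"
      unfolding abs_mult
      using ys_moment [OF a] \<eta>(1) by (intro sum_mono mult_mono v_le mult_nonneg_nonneg W prod_nonneg) (auto intro: less_imp_le)
    also have "\<dots> = c * \<eta>" by (simp add: c_def sum_distrib_right)
    finally show "\<bar>(\<Sum>(x, w)\<leftarrow>xs. w * (\<Prod>j\<in>UNIV. x $ j ^ a j)) - L (\<Prod>j\<in>UNIV. X j ^ a j)\<bar> < \<epsilon>"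
      using N [OF \<open>a \<in> A\<close>] \<eta>(2) unfolding atoms by linarith
  qed
qed

section \<open>Limits of moment sequences\<close>

text \<open>Points of a Cantor set: base 3 with the digits 0 and 1 only leaves gaps, so that close
  values have equal leading digits, which fails for binary expansions.\<close>

definition ternary :: "(nat \<Rightarrow> bool) \<Rightarrow> real"
  where "ternary b = suminf (\<lambda>k. of_bool (b k) * (1 / 3) ^ Suc k)"

lemma summable_ternary: "summable (\<lambda>k. of_bool (b k) * (1 / 3 :: real) ^ Suc k)"
proof (rule summable_comparison_test' [of "\<lambda>k. (1 / 3 :: real) ^ Suc k" 0])
  show "summable (\<lambda>k. (1 / 3 :: real) ^ Suc k)"
    by (simp add: summable_geometric summable_mult)
qed auto

lemma ternary_bounds: "0 \<le> ternary b" "ternary b \<le> 1 / 2"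
proof -
  show "0 \<le> ternary b" unfolding ternary_def by (intro suminf_nonneg summable_ternary) auto
  have "(\<lambda>k. (1 / 3 :: real) * (1 / 3) ^ k) sums (1 / 3 * (1 / (1 - 1 / 3)))"
    by (intro sums_mult geometric_sums) auto
  then have sums: "(\<lambda>k. (1 / 3 :: real) ^ Suc k) sums (1 / 2)" by simp
  have "ternary b \<le> suminf (\<lambda>k. (1 / 3) ^ Suc k)"
    unfolding ternary_def using sums
    by (intro suminf_le summable_ternary) (auto simp: sums_iff)
  then show "ternary b \<le> 1 / 2" using sums by (simp add: sums_iff)
qed

lemma ternary_shift: "ternary b = (of_bool (b 0) + ternary (\<lambda>k. b (Suc k))) / 3"
proof -
  have "ternary b = of_bool (b 0) * (1 / 3) ^ Suc 0 + suminf (\<lambda>k. of_bool (b (Suc k)) * (1 / 3) ^ Suc (Suc k))"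
    unfolding ternary_def using suminf_split_head [OF summable_ternary [of b]] by simp
  also have "suminf (\<lambda>k. of_bool (b (Suc k)) * (1 / 3 :: real) ^ Suc (Suc k)) = ternary (\<lambda>k. b (Suc k)) * (1 / 3)"
    unfolding ternary_def by (subst suminf_mult2 [OF summable_ternary]) (simp add: mult.assoc)
  finally show ?thesis by (simp add: field_simps)
qed

text \<open>The tails lie between 0 and 1/2, so different first digits would put the values at least
  1/6 apart. Once the first digits agree, the distance of the tails is three times the original
  one.\<close>

lemma ternary_close_imp_eq:
  "\<bar>ternary b - ternary b'\<bar> < (1 / 3) ^ n / 2 \<Longrightarrow> k < n \<Longrightarrow> b k = b' k"
proof (induction n arbitrary: b b' k)
  case 0
  then show ?case by simp
next
  case (Suc n)
  let ?c = "\<lambda>k. b (Suc k)" and ?c' = "\<lambda>k. b' (Suc k)"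
  have diff: "ternary b - ternary b' = (of_bool (b 0) - of_bool (b' 0) + (ternary ?c - ternary ?c')) / 3"
    by (subst (1 2) ternary_shift) (simp add: field_simps)
  have "(1 / 3 :: real) ^ n \<le> 1" by (simp add: power_le_one)
  then have "\<bar>of_bool (b 0) - of_bool (b' 0) + (ternary ?c - ternary ?c')\<bar> < 1 / 2"
    using Suc.prems(1) unfolding diff by simp
  then have b0: "b 0 = b' 0"
    using ternary_bounds [of ?c] ternary_bounds [of ?c'] by (cases "b 0"; cases "b' 0"; simp)
  then have "\<bar>ternary ?c - ternary ?c'\<bar> < (1 / 3) ^ n / 2"
    using Suc.prems(1) unfolding diff by simp
  note IH = Suc.IH [OF this]
  show ?case
  proof (cases k)
    case 0
    with b0 show ?thesis by simp
  next
    case (Suc i)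
    with IH [of i] Suc.prems(2) show ?thesis by simp
  qed
qed

text \<open>The integer parts of the coordinates are encoded in the integer part, their binary digits in
  the ternary digits.\<close>

definition real_code :: "real ^ 'n::finite \<Rightarrow> real"
  where "real_code x = 2 * real (to_nat (\<lambda>j. \<lfloor>x $ j\<rfloor>)) +
    ternary (\<lambda>k. let (i, j) = from_nat k in odd \<lfloor>2 ^ i * x $ j\<rfloor>)"

text \<open>The recursion by which integer part and binary digits determine the floor at every
  dyadic scale.\<close>

lemma floor_double: "\<lfloor>2 * y\<rfloor> = 2 * \<lfloor>y\<rfloor> + of_bool (odd \<lfloor>2 * y\<rfloor>)" for y :: real
proof -
  have "\<lfloor>2 * y\<rfloor> = 2 * \<lfloor>y\<rfloor> \<or> \<lfloor>2 * y\<rfloor> = 2 * \<lfloor>y\<rfloor> + 1" by linarith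
  then show ?thesis by auto
qed

text \<open>Close codes share the integer parts and the first \<open>I\<close> binary digits of all
  coordinates, which confines each coordinate difference to less than \<open>(1 / 2) ^ I\<close>.
  Hence the inverse of \<open>real_code\<close> is uniformly continuous.\<close>

lemma real_code_close:
  fixes x :: "real ^ 'n::finite"
  assumes "e > 0"
  obtains d where "d > 0" "\<And>x y :: real ^ 'n. \<bar>real_code x - real_code y\<bar> < d \<Longrightarrow> dist x y < e"
proof -
  obtain I where I: "(1 / 2 :: real) ^ I < e / CARD('n)"
    using real_arch_pow_inv [of "e / CARD('n)" "1 / 2"] assms by auto
  \<comment> \<open>Beyond the positions of all digits up to scale \<open>I\<close> in the
    enumeration of pairs.\<close>
  define K where "K = Suc (Max (to_nat ` ({..I} \<times> (UNIV :: 'n set))))"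
  define d where "d = min 1 ((1 / 3 :: real) ^ K / 2)"
  show thesis
  proof (rule that [of d])
    show "d > 0" by (simp add: d_def)
    fix x y :: "real ^ 'n" assume close: "\<bar>real_code x - real_code y\<bar> < d"
    define b where "b x = (\<lambda>k. let (i, j) = from_nat k in odd \<lfloor>2 ^ i * x $ j\<rfloor>)" for x :: "real ^ 'n"
    define z where "z x = to_nat (\<lambda>j. \<lfloor>x $ j\<rfloor>)" for x :: "real ^ 'n"
    have code: "real_code x = 2 * real (z x) + ternary (b x)" for x :: "real ^ 'n"
      by (simp add: real_code_def b_def z_def)
    \<comment> \<open>The factor 2 in the code matters here: different integer parts put the codes
      at least 2 - 1/2 apart, more than \<open>d \<le> 1\<close>.\<close>
    have z: "z x = z y"
    proof (rule ccontr)
      assume "z x \<noteq> z y"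
      then have "\<bar>real (z x) - real (z y)\<bar> \<ge> 1" by linarith
      then show False
        using close ternary_bounds [of "b x"] ternary_bounds [of "b y"]
        unfolding code d_def by linarith
    qed
    then have "\<bar>ternary (b x) - ternary (b y)\<bar> < (1 / 3) ^ K / 2"
      using close by (simp add: code d_def)
    note eq = ternary_close_imp_eq [OF this]
    have digits: "odd \<lfloor>2 ^ i * x $ j\<rfloor> = odd \<lfloor>2 ^ i * y $ j\<rfloor>" if "i \<le> I" for i j
    proof -
      have "to_nat (i, j) < K"
        unfolding K_def less_Suc_eq_le using that by (intro Max_ge) auto
      from eq [OF this] show ?thesis by (simp add: b_def)
    qed
    have floors: "\<lfloor>2 ^ i * x $ j\<rfloor> = \<lfloor>2 ^ i * y $ j\<rfloor>" if "i \<le> I" for i j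
      using that
    proof (induction i)
      case 0
      from z have "(\<lambda>j. \<lfloor>x $ j\<rfloor>) = (\<lambda>j. \<lfloor>y $ j\<rfloor>)" by (simp add: z_def)
      then show ?case by (simp add: fun_eq_iff)
    next
      case (Suc i)
      then show ?case
        using floor_double [of "2 ^ i * x $ j"] floor_double [of "2 ^ i * y $ j"] digits [of "Suc i" j]
        by (simp add: mult.assoc)
    qed
    have "\<bar>(x - y) $ j\<bar> < e / CARD('n)" for j
    proof -
      have "\<bar>2 ^ I * x $ j - 2 ^ I * y $ j\<bar> < 1" using floors [of I j] by linarith
      then have "2 ^ I * \<bar>x $ j - y $ j\<bar> < 1" by (simp add: abs_mult flip: right_diff_distrib)
      then have "\<bar>x $ j - y $ j\<bar> < (1 / 2) ^ I" by (simp add: field_simps)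
      with I show ?thesis by simp
    qed
    then have "(\<Sum>j\<in>UNIV. \<bar>(x - y) $ j\<bar>) < (\<Sum>j\<in>(UNIV :: 'n set). e / CARD('n))"
      by (intro sum_strict_mono) auto
    then show "dist x y < e"
      using norm_le_l1_cart [of "x - y"] by (simp add: dist_norm)
  qed
qed

text \<open>A ball meets only finitely many vectors of integer parts. This transfers tightness to
  the line.\<close>

lemma real_code_bounded: "\<exists>B. \<forall>x :: real ^ 'n::finite. norm x \<le> K \<longrightarrow> \<bar>real_code x\<bar> \<le> B"
proof -
  define F where "F = to_nat ` (PiE (UNIV :: 'n set) (\<lambda>_. {\<lfloor>- K\<rfloor>..\<lceil>K\<rceil>}))"
  have "finite F" by (simp add: F_def finite_PiE)
  have "\<bar>real_code x\<bar> \<le> 2 * real (Max F) + 1 / 2" if "norm x \<le> K" for x :: "real ^ 'n"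
  proof -
    have "\<lfloor>x $ j\<rfloor> \<in> {\<lfloor>- K\<rfloor>..\<lceil>K\<rceil>}" for j
    proof -
      have "- K \<le> x $ j" "x $ j \<le> K"
        using component_le_norm_cart [of x j] that by linarith+
      then have "\<lfloor>- K\<rfloor> \<le> \<lfloor>x $ j\<rfloor>" "\<lfloor>x $ j\<rfloor> \<le> \<lceil>K\<rceil>"
        using floor_le_ceiling [of K] by (auto intro: floor_mono order_trans)
      then show ?thesis by simp
    qed
    then have "to_nat (\<lambda>j. \<lfloor>x $ j\<rfloor>) \<in> F" by (auto simp: F_def)
    then have "to_nat (\<lambda>j. \<lfloor>x $ j\<rfloor>) \<le> Max F" using \<open>finite F\<close> by simp
    then show ?thesis
      using ternary_bounds [of "\<lambda>k. let (i, j) = from_nat k in odd \<lfloor>2 ^ i * x $ j\<rfloor>"]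
      unfolding real_code_def by linarith
  qed
  then show ?thesis by blast
qed

text \<open>The inverse of \<open>real_code\<close> is uniformly continuous on the range, extends to
  its closure, and from there to the whole line by Dugundji's theorem.\<close>

lemma continuous_decoding:
  obtains \<pi> :: "real \<Rightarrow> real ^ 'n::finite" where "continuous_on UNIV \<pi>" "\<And>x. \<pi> (real_code x) = x"
proof -
  define h where "h = inv_into (UNIV :: (real ^ 'n) set) real_code"
  have "inj (real_code :: real ^ 'n \<Rightarrow> real)"
  proof (rule injI, rule ccontr)
    fix x y :: "real ^ 'n" assume "real_code x = real_code y" "x \<noteq> y"
    then show False using real_code_close [of "dist x y", where 'n = 'n] by (metis abs_zero diff_self less_irrefl zero_less_dist_iff)
  qed
  then have h: "h (real_code x) = x" for x by (simp add: h_def)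
  define C where "C = range (real_code :: real ^ 'n \<Rightarrow> real)"
  have "uniformly_continuous_on (C) h"
    unfolding uniformly_continuous_on_def
  proof (intro allI impI)
    fix e :: real assume "e > 0"
    then obtain d where d: "d > 0" "\<And>x y :: real ^ 'n. \<bar>real_code x - real_code y\<bar> < d \<Longrightarrow> dist x y < e"
      using real_code_close by blast
    then show "\<exists>d>0. \<forall>x\<in>C. \<forall>x'\<in>C. dist x' x < d \<longrightarrow> dist (h x') (h x) < e"
      by (intro exI [of _ d]) (auto simp: C_def h dist_real_def)
  qed
  then obtain g where g: "uniformly_continuous_on (closure (C)) g"
      "\<And>z. z \<in> C \<Longrightarrow> h z = g z"
    using uniformly_continuous_on_extension_on_closure by metis
  obtain \<pi> where \<pi>: "continuous_on UNIV \<pi>" "\<And>z. z \<in> closure (C) \<Longrightarrow> \<pi> z = g z"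
  proof (rule Dugundji [of "UNIV :: (real ^ 'n) set" UNIV "closure (C)" g])
    show "continuous_on (closure (C)) g"
      using g(1) by (rule uniformly_continuous_imp_continuous)
  qed auto
  have "\<pi> (real_code x) = x" for x
    using \<pi>(2) [of "real_code x"] g(2) [of "real_code x"] h [of x] closure_subset [of C]
    by (auto simp: C_def)
  with \<pi>(1) show thesis by (rule that)
qed

section \<open>Passage to the limit in the moments\<close>

text \<open>Truncating \<open>g\<close> at height \<open>R\<close> changes its integrals by at most
  \<open>B / R\<close>, uniformly in \<open>n\<close>, and weak convergence applies to the bounded
  continuous truncation.\<close>

lemma weak_conv_m_uniformly_integrable:
  fixes g :: "real \<Rightarrow> real"
  assumes \<mu>: "\<And>n. real_distribution (\<mu> n)" and M: "real_distribution M" and conv: "weak_conv_m \<mu> M"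
    and g: "continuous_on UNIV g"
    and int: "\<And>n. integrable (\<mu> n) (\<lambda>x. (g x)\<^sup>2)" and B: "\<And>n. (\<integral>x. (g x)\<^sup>2 \<partial>\<mu> n) \<le> B"
  shows "integrable M g" "(\<lambda>n. \<integral>x. g x \<partial>\<mu> n) \<longlonglongrightarrow> (\<integral>x. g x \<partial>M)"
proof -
  interpret M: real_distribution M by fact
  interpret \<mu>: real_distribution "\<mu> n" for n by (rule \<mu>)
  have meas [measurable]: "g \<in> borel_measurable borel"
    using g by (rule borel_measurable_continuous_onI)
  have bdd_conv: "(\<lambda>n. \<integral>x. f x \<partial>\<mu> n) \<longlonglongrightarrow> (\<integral>x. f x \<partial>M)"
    if "continuous_on UNIV f" "\<And>x. \<bar>f x\<bar> \<le> R" for f :: "real \<Rightarrow> real" and R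
    using that
    by (intro weak_conv_imp_integral_bdd_continuous_conv [OF \<mu> M conv, where B = R])
      (auto simp: continuous_on_eq_continuous_at)
  have bdd_int: "integrable M f" "integrable (\<mu> n) f"
    if "continuous_on UNIV f" "\<And>x. \<bar>f x\<bar> \<le> R" for f :: "real \<Rightarrow> real" and R n
  proof -
    have "f \<in> borel_measurable borel" using that(1) by (rule borel_measurable_continuous_onI)
    then show "integrable M f" "integrable (\<mu> n) f"
      using that(2) by (auto intro!: M.integrable_const_bound [where B = R] \<mu>.integrable_const_bound [where B = R])
  qed
  \<comment> \<open>The bound \<open>B\<close> passes to the limit measure for the truncated
    squares, and by monotone convergence for \<open>(g x)^2\<close> itself.\<close>
  define q where "q R x = min (real R) ((g x)\<^sup>2)" for R :: nat and x
  have q: "continuous_on UNIV (q R)" "\<bar>q R x\<bar> \<le> real R" for R x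
    unfolding q_def using g by (auto intro!: continuous_intros)
  have q_le: "(\<integral>x. q R x \<partial>M) \<le> B" for R
  proof (rule LIMSEQ_le_const2 [OF bdd_conv [OF q]])
    have "(\<integral>x. q R x \<partial>\<mu> n) \<le> (\<integral>x. (g x)\<^sup>2 \<partial>\<mu> n)" for n
      by (intro integral_mono int bdd_int [OF q]) (simp add: q_def)
    with B show "\<exists>N. \<forall>n\<ge>N. (\<integral>x. q R x \<partial>\<mu> n) \<le> B" by (meson order_trans)
  qed
  have q_mono: "incseq (\<lambda>R. \<integral>x. q R x \<partial>M)"
    by (intro incseq_SucI integral_mono bdd_int [OF q]) (auto simp: q_def)
  obtain b where b: "(\<lambda>R. \<integral>x. q R x \<partial>M) \<longlonglongrightarrow> b"
    using incseq_convergent [OF q_mono, of B] q_le by blast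
  have lim_q: "(\<lambda>R. q R x) \<longlonglongrightarrow> (g x)\<^sup>2" for x
  proof (rule tendsto_eventually)
    obtain R0 :: nat where R0: "(g x)\<^sup>2 \<le> real R0" using real_arch_simple by blast
    show "\<forall>\<^sub>F R in sequentially. q R x = (g x)\<^sup>2"
      using eventually_ge_at_top [of R0]
      by eventually_elim (use R0 in \<open>simp add: q_def\<close>)
  qed
  have M_int: "integrable M (\<lambda>x. (g x)\<^sup>2)"
    by (rule integral_monotone_convergence_nonneg [where f = q, OF bdd_int(1) [OF q] _ _ _ b])
      (auto simp: q_def mono_def lim_q [unfolded q_def])
  have "(\<integral>x. (g x)\<^sup>2 \<partial>M) = b"
    by (rule integral_monotone_convergence_nonneg [where f = q, OF bdd_int(1) [OF q] _ _ _ b])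
      (auto simp: q_def mono_def lim_q [unfolded q_def])
  then have M_B: "(\<integral>x. (g x)\<^sup>2 \<partial>M) \<le> B"
    using LIMSEQ_le_const2 [OF b] q_le by blast
  have abs_le: "\<bar>g x\<bar> \<le> 1 + (g x)\<^sup>2" for x
    using zero_le_power2 [of "\<bar>g x\<bar> - 1"] by (simp add: power2_eq_square algebra_simps)
  show g_int: "integrable M g"
  proof (rule Bochner_Integration.integrable_bound)
    show "integrable M (\<lambda>x. 1 + (g x)\<^sup>2)" using M_int by simp
    show "AE x in M. norm (g x) \<le> norm (1 + (g x)\<^sup>2)"
      using order_trans [OF abs_le abs_ge_self] by simp
  qed simp
  have g_int': "integrable (\<mu> n) g" for n
  proof (rule Bochner_Integration.integrable_bound)
    show "integrable (\<mu> n) (\<lambda>x. 1 + (g x)\<^sup>2)" using int by simp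
    show "AE x in \<mu> n. norm (g x) \<le> norm (1 + (g x)\<^sup>2)"
      using order_trans [OF abs_le abs_ge_self] by simp
  qed simp
  have "B \<ge> 0" using M_B by (rule order_trans [rotated]) simp
  show "(\<lambda>n. \<integral>x. g x \<partial>\<mu> n) \<longlonglongrightarrow> (\<integral>x. g x \<partial>M)"
  proof (rule metric_LIMSEQ_I)
    fix e :: real assume "e > 0"
    define R where "R = 3 * (B + 1) / e"
    have R: "R > 0" "B / R < e / 3"
      using \<open>e > 0\<close> \<open>B \<ge> 0\<close> by (auto simp: R_def field_simps)
    define f where "f x = max (- R) (min R (g x))" for x
    have f: "continuous_on UNIV f" "\<bar>f x\<bar> \<le> R" for x
      unfolding f_def using g R by (auto intro!: continuous_intros)
    have diff: "\<bar>g x - f x\<bar> \<le> (g x)\<^sup>2 / R" for x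
    proof (cases "\<bar>g x\<bar> \<le> R")
      case True
      then show ?thesis using R by (simp add: f_def)
    next
      case False
      then have "\<bar>g x - f x\<bar> \<le> \<bar>g x\<bar>" using R by (auto simp: f_def)
      also have "\<dots> \<le> (g x)\<^sup>2 / R"
        using mult_left_mono [of R "\<bar>g x\<bar>" "\<bar>g x\<bar>"] False R
        by (simp add: pos_le_divide_eq power2_eq_square)
      finally show ?thesis .
    qed
    have close: "\<bar>(\<integral>x. g x \<partial>N) - (\<integral>x. f x \<partial>N)\<bar> < e / 3"
      if "integrable N g" "integrable N f" "integrable N (\<lambda>x. (g x)\<^sup>2)" "(\<integral>x. (g x)\<^sup>2 \<partial>N) \<le> B" for N
    proof -
      have "\<bar>(\<integral>x. g x \<partial>N) - (\<integral>x. f x \<partial>N)\<bar> = \<bar>\<integral>x. g x - f x \<partial>N\<bar>"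
        using that by simp
      also have "\<dots> \<le> (\<integral>x. \<bar>g x - f x\<bar> \<partial>N)" by (rule integral_abs_bound)
      also have "\<dots> \<le> (\<integral>x. (g x)\<^sup>2 / R \<partial>N)"
        using that diff by (intro integral_mono) auto
      also have "\<dots> \<le> B / R" using that R by (simp add: divide_right_mono)
      finally show ?thesis using R(2) by linarith
    qed
    obtain n0 where n0: "\<And>n. n \<ge> n0 \<Longrightarrow> dist (\<integral>x. f x \<partial>\<mu> n) (\<integral>x. f x \<partial>M) < e / 3"
      using metric_LIMSEQ_D [OF bdd_conv [OF f], of "e / 3"] \<open>e > 0\<close> by auto
    have "dist (\<integral>x. g x \<partial>\<mu> n) (\<integral>x. g x \<partial>M) < e" if "n \<ge> n0" for n
      using n0 [OF that] close [OF g_int' bdd_int(2) [OF f] int B, of n]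
        close [OF g_int bdd_int(1) [OF f] M_int M_B]
      unfolding dist_real_def by linarith
    then show "\<exists>n0. \<forall>n\<ge>n0. dist (\<integral>x. g x \<partial>\<mu> n) (\<integral>x. g x \<partial>M) < e" by blast
  qed
qed

text \<open>Bounded second moments make the coded measures tight, so a subsequence converges weakly
  on the line. The square of a monomial is a monomial, hence has bounded integrals, so all moments
  converge; the decoding carries the limit back.\<close>

lemma moment_sequence_limit:
  fixes P :: "nat \<Rightarrow> (real ^ 'n::finite) pmf"
  assumes fin: "\<And>n. finite (set_pmf (P n))"
    and lim: "\<And>a :: 'n \<Rightarrow> nat. (\<lambda>n. \<integral>x. (\<Prod>j\<in>UNIV. x $ j ^ a j) \<partial>measure_pmf (P n)) \<longlonglongrightarrow> l a"
  obtains \<mu> :: "(real ^ 'n) measure" where "sets \<mu> = sets borel"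
    "\<And>a. integrable \<mu> (\<lambda>x. \<Prod>j\<in>UNIV. x $ j ^ a j)"
    "\<And>a. (\<integral>x. (\<Prod>j\<in>UNIV. x $ j ^ a j) \<partial>\<mu>) = l a"
proof -
  define mono where "mono a x = (\<Prod>j\<in>UNIV. x $ j ^ a j)" for a :: "'n \<Rightarrow> nat" and x :: "real ^ 'n"
  note lim = lim [folded mono_def]
  obtain \<pi> :: "real \<Rightarrow> real ^ 'n" where \<pi>: "continuous_on UNIV \<pi>" and \<pi>_code: "\<And>x. \<pi> (real_code x) = x"
    using continuous_decoding by blast
  have int: "integrable (measure_pmf (P n)) f" for n and f :: "real ^ 'n \<Rightarrow> real"
    by (rule integrable_measure_pmf_finite [OF fin])
  have bounded: "\<exists>B. \<forall>n. (\<integral>x. mono a x \<partial>measure_pmf (P n)) \<le> B" for a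
  proof -
    have "Bseq (\<lambda>n. \<integral>x. mono a x \<partial>measure_pmf (P n))"
      using lim convergentI convergent_imp_Bseq by blast
    then show ?thesis by (auto simp: Bseq_def abs_le_iff)
  qed
  have mono_sq: "(mono a x)\<^sup>2 = mono (\<lambda>j. a j * 2) x" for a x
    by (simp add: mono_def prod_power_distrib power_mult)
  \<comment> \<open>Every set is measurable for \<open>measure_pmf\<close>, so that the
    discontinuous \<open>real_code\<close> may be used for the image measure.\<close>
  define Q where "Q n = distr (measure_pmf (P n)) borel real_code" for n
  have Q: "real_distribution (Q n)" for n
    unfolding Q_def real_distribution_def real_distribution_axioms_def
    by (auto intro!: measure_pmf.prob_space_distr)
  have mono_\<pi>: "continuous_on UNIV (\<lambda>z. mono a (\<pi> z))" for a
    unfolding mono_def using \<pi> by (intro continuous_intros)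
  have Q_int: "integrable (Q n) f" if [measurable]: "f \<in> borel_measurable borel" for n and f :: "real \<Rightarrow> real"
    unfolding Q_def by (subst integrable_distr_eq) (auto intro: integrable_measure_pmf_finite [OF fin])
  have Q_mono: "(\<integral>z. mono a (\<pi> z) \<partial>Q n) = (\<integral>x. mono a x \<partial>measure_pmf (P n))" for a n
    unfolding Q_def using borel_measurable_continuous_onI [OF mono_\<pi>, of a]
    by (subst integral_distr) (auto simp: \<pi>_code)
  have "tight Q"
    unfolding tight_def
  proof (intro conjI allI impI Q)
    fix \<epsilon> :: real assume "\<epsilon> > 0"
    have norm_sq: "(norm x)\<^sup>2 = (\<Sum>j\<in>UNIV. mono (\<lambda>i. if i = j then 2 else 0) x)" for x :: "real ^ 'n"
    proof -
      have "mono (\<lambda>i. if i = j then 2 else 0) x = (x $ j)\<^sup>2" for j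
      proof -
        have "mono (\<lambda>i. if i = j then 2 else 0) x = (\<Prod>i\<in>UNIV. if i = j then (x $ j)\<^sup>2 else 1)"
          unfolding mono_def by (intro prod.cong) auto
        then show ?thesis by simp
      qed
      then show ?thesis
        by (simp only: power2_norm_eq_inner inner_vec_def) (simp add: power2_eq_square)
    qed
    have "\<forall>j. \<exists>B. \<forall>n. (\<integral>x. mono (\<lambda>i. if i = j then 2 else 0) x \<partial>measure_pmf (P n)) \<le> B"
      using bounded by (rule allI)
    from choice [OF this] obtain b
      where b: "\<And>j n. (\<integral>x. mono (\<lambda>i. if i = j then 2 else 0) x \<partial>measure_pmf (P n)) \<le> b j"
      by auto
    define B where "B = \<bar>\<Sum>j\<in>UNIV. b j\<bar>"
    have E_norm: "(\<integral>x. (norm x)\<^sup>2 \<partial>measure_pmf (P n)) \<le> B" for n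
    proof -
      have "(\<integral>x. (norm x)\<^sup>2 \<partial>measure_pmf (P n)) = (\<Sum>j\<in>UNIV. \<integral>x. mono (\<lambda>i. if i = j then 2 else 0) x \<partial>measure_pmf (P n))"
        unfolding norm_sq by (rule Bochner_Integration.integral_sum) (rule int)
      also have "\<dots> \<le> (\<Sum>j\<in>UNIV. b j)" by (intro sum_mono b)
      finally show ?thesis by (simp add: B_def)
    qed
    define K where "K = 1 + B / \<epsilon>"
    have "B \<ge> 0" by (simp add: B_def)
    then have K: "K \<ge> 1" "B < K * \<epsilon>" using \<open>\<epsilon> > 0\<close> by (simp_all add: K_def field_simps)
    have "K * 1 \<le> K\<^sup>2" unfolding power2_eq_square using K by (intro mult_left_mono) auto
    then have "K * \<epsilon> \<le> K\<^sup>2 * \<epsilon>" using \<open>\<epsilon> > 0\<close> by simp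
    then have BK: "B / K\<^sup>2 < \<epsilon>" using K by (simp add: field_simps)
    obtain c where c: "\<And>x :: real ^ 'n. norm x \<le> K \<Longrightarrow> \<bar>real_code x\<bar> \<le> c"
      using real_code_bounded [of K, where 'n = 'n] by blast
    \<comment> \<open>Markov's inequality bounds the mass outside the ball of radius
      \<open>K\<close>. Tightness speaks of half-open intervals, so the left end is moved by 1 to
      include \<open>- \<bar>c\<bar>\<close>.\<close>
    have "1 - \<epsilon> < measure (Q n) {- \<bar>c\<bar> - 1 <.. \<bar>c\<bar>}" for n
    proof -
      have "measure (measure_pmf (P n)) {x. K\<^sup>2 \<le> (norm x)\<^sup>2} \<le> (\<integral>x. (norm x)\<^sup>2 \<partial>measure_pmf (P n)) / K\<^sup>2"
        using integral_Markov_inequality_measure [where M = "measure_pmf (P n)" and A = UNIV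
            and u = "\<lambda>x. (norm x)\<^sup>2" and c = "K\<^sup>2", OF int] K by simp
      also have "\<dots> \<le> B / K\<^sup>2" by (intro divide_right_mono E_norm) simp
      finally have "measure (measure_pmf (P n)) {x. K\<^sup>2 \<le> (norm x)\<^sup>2} < \<epsilon>" using BK by linarith
      then have "1 - \<epsilon> < measure (measure_pmf (P n)) (- {x. K\<^sup>2 \<le> (norm x)\<^sup>2})"
        using measure_pmf.prob_compl [of "{x. K\<^sup>2 \<le> (norm x)\<^sup>2}" "P n"] by (simp add: Compl_eq_Diff_UNIV)
      also have "\<dots> \<le> measure (measure_pmf (P n)) (real_code -` {- \<bar>c\<bar> - 1 <.. \<bar>c\<bar>})"
      proof (intro measure_pmf.finite_measure_mono subsetI)
        fix x :: "real ^ 'n" assume "x \<in> - {x. K\<^sup>2 \<le> (norm x)\<^sup>2}"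
        then have "norm x \<le> K" using K power2_le_imp_le [of "norm x" K] by simp
        from c [OF this] show "x \<in> real_code -` {- \<bar>c\<bar> - 1 <.. \<bar>c\<bar>}" by auto
      qed simp
      also have "\<dots> = measure (Q n) {- \<bar>c\<bar> - 1 <.. \<bar>c\<bar>}"
        by (simp add: Q_def measure_distr)
      finally show ?thesis .
    qed
    then show "\<exists>a b. a < b \<and> (\<forall>n. 1 - \<epsilon> < measure (Q n) {a<..b})"
      by (intro exI [of _ "- \<bar>c\<bar> - 1"] exI [of _ "\<bar>c\<bar>"]) auto
  qed
  then obtain r M where r: "strict_mono r" and M: "real_distribution M" and conv: "weak_conv_m (Q \<circ> id \<circ> r) M"
    using tight_imp_convergent_subsubsequence [OF _ strict_mono_id] by blast
  interpret M: real_distribution M by (rule M)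
  have \<pi>_meas [measurable]: "\<pi> \<in> borel_measurable borel"
    using \<pi> by (rule borel_measurable_continuous_onI)
  have mono_meas [measurable]: "mono a \<in> borel_measurable borel" for a
    unfolding mono_def by measurable
  have *: "integrable M (\<lambda>z. mono a (\<pi> z))" "(\<integral>z. mono a (\<pi> z) \<partial>M) = l a" for a
  proof -
    obtain B where B: "\<And>n. (\<integral>x. mono (\<lambda>j. a j * 2) x \<partial>measure_pmf (P n)) \<le> B"
      using bounded by blast
    have 1: "real_distribution ((Q \<circ> id \<circ> r) n)" for n
      by (simp add: Q)
    have 2: "integrable ((Q \<circ> id \<circ> r) n) (\<lambda>z. (mono a (\<pi> z))\<^sup>2)" for n
      by (auto intro!: Q_int)
    have 3: "(\<integral>z. (mono a (\<pi> z))\<^sup>2 \<partial>(Q \<circ> id \<circ> r) n) \<le> B" for n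
      by (simp add: mono_sq Q_mono B)
    note weak_conv_m_uniformly_integrable [OF 1 M conv mono_\<pi> 2 3]
    moreover have "(\<lambda>n. \<integral>z. mono a (\<pi> z) \<partial>(Q \<circ> id \<circ> r) n) \<longlonglongrightarrow> l a"
      using LIMSEQ_subseq_LIMSEQ [OF lim r, of a] by (simp add: Q_mono comp_def)
    ultimately show "integrable M (\<lambda>z. mono a (\<pi> z))" "(\<integral>z. mono a (\<pi> z) \<partial>M) = l a"
      using LIMSEQ_unique by blast+
  qed
  show thesis
  proof (rule that [of "distr M borel \<pi>"])
    show "integrable (distr M borel \<pi>) (\<lambda>x. \<Prod>j\<in>UNIV. x $ j ^ a j)" for a
      using *(1) [of a] mono_meas [of a] by (simp add: integrable_distr_eq mono_def)
    show "(\<integral>x. (\<Prod>j\<in>UNIV. x $ j ^ a j) \<partial>distr M borel \<pi>) = l a" for a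
      using *(2) [of a] mono_meas [of a] by (simp add: integral_distr mono_def)
  qed simp
qed

section \<open>Determinacy\<close>

lemma integrable_mpoly_eval:
  assumes "finite_moments \<mu>"
  shows "integrable \<mu> (mpoly_eval f)"
  using assms unfolding mpoly_eval_def [abs_def] finite_moments_def
  by (intro Bochner_Integration.integrable_sum integrable_mult_right) auto

lemma borel_measurable_mpoly_eval: "mpoly_eval f \<in> borel_measurable borel"
  for f :: "('n::finite, real) mpoly"
  unfolding mpoly_eval_def [abs_def] by measurable

lemma moment_functional_linear:
  assumes "finite_moments \<mu>"
  shows "linear (moment_functional \<mu>)"
proof
  show "moment_functional \<mu> (f + g) = moment_functional \<mu> f + moment_functional \<mu> g" for f g
    using integrable_mpoly_eval [OF assms] by (simp add: moment_functional_def mpoly_eval_add)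
  show "moment_functional \<mu> (c *\<^sub>R f) = c *\<^sub>R moment_functional \<mu> f" for c f
    by (simp add: moment_functional_def mpoly_eval_mult mpoly_eval_Const scaleR_eq_Const_mult)
qed

text \<open>Pointwise, \<open>f * Q k - f / p\<close> equals \<open>- f * h k / p\<close> with
  \<open>p = 1 + (x $ j)^2\<close>. As \<open>w / p \<le> 1\<close>, a weighted inequality of
  arithmetic and geometric means bounds its product with \<open>w\<close> by the squares of
  \<open>f\<close> and \<open>h k\<close>. The weight \<open>w\<close> stands for denominators
  introduced before.\<close>

lemma localized_integral:
  fixes \<mu> :: "(real ^ 'n::finite) measure"
  assumes \<mu>: "borel_measure \<mu>" "finite_moments \<mu>"
    and lim: "(\<lambda>k. moment_functional \<mu> ((1 - (1 + (X j)\<^sup>2) * Q k)\<^sup>2)) \<longlonglongrightarrow> 0"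
    and w: "w \<in> borel_measurable borel" "\<And>x. 0 \<le> w x" "\<And>x. w x \<le> 1"
  shows "(\<lambda>k. \<integral>x. mpoly_eval (f * Q k) x * w x \<partial>\<mu>)
    \<longlonglongrightarrow> (\<integral>x. mpoly_eval f x * (w x / (1 + (x $ j)\<^sup>2)) \<partial>\<mu>)"
proof (rule metric_LIMSEQ_I)
  fix e :: real assume "e > 0"
  have sets: "sets \<mu> = sets borel" using \<mu>(1) by (simp add: borel_measure_def)
  have [measurable]: "mpoly_eval g \<in> borel_measurable \<mu>" for g
    using borel_measurable_mpoly_eval by (simp cong: measurable_cong_sets add: sets)
  have [measurable]: "w \<in> borel_measurable \<mu>" "(\<lambda>x. x $ i) \<in> borel_measurable \<mu>" for i
    using w(1) by (simp_all cong: measurable_cong_sets add: sets)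
  note int = integrable_mpoly_eval [OF \<mu>(2)]
  define h where "h k = 1 - (1 + (X j)\<^sup>2) * Q k" for k
  define F where "F = (\<integral>x. mpoly_eval (f\<^sup>2) x \<partial>\<mu>)"
  \<comment> \<open>Makes the contribution of \<open>f^2\<close> smaller than \<open>e\<close>; for
    large \<open>k\<close> that of \<open>h k\<close>, divided by \<open>\<eta>\<close>, is smaller
    than \<open>e\<close> too.\<close>
  define \<eta> where "\<eta> = e / (F + 1)"
  have "F \<ge> 0" unfolding F_def by (simp add: mpoly_eval_power)
  then have \<eta>: "\<eta> > 0" "\<eta> * F < e" using \<open>e > 0\<close> by (simp_all add: \<eta>_def field_simps)
  have "\<forall>\<^sub>F k in sequentially. moment_functional \<mu> ((h k)\<^sup>2) < \<eta> * e"
    using \<eta> \<open>e > 0\<close> unfolding h_def by (intro order_tendstoD(2) [OF lim]) simp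
  then obtain k0 where k0: "\<And>k. k \<ge> k0 \<Longrightarrow> moment_functional \<mu> ((h k)\<^sup>2) < \<eta> * e"
    by (auto simp: eventually_sequentially)
  have int1: "integrable \<mu> (\<lambda>x. mpoly_eval g x * w x)" for g
  proof (rule Bochner_Integration.integrable_bound [OF int [of g]])
    show "AE x in \<mu>. norm (mpoly_eval g x * w x) \<le> norm (mpoly_eval g x)"
      using w by (auto simp: abs_mult intro!: mult_left_le)
  qed measurable
  have int2: "integrable \<mu> (\<lambda>x. mpoly_eval f x * (w x / (1 + (x $ j)\<^sup>2)))"
  proof (rule Bochner_Integration.integrable_bound [OF int [of f]])
    have "w x / (1 + (x $ j)\<^sup>2) \<le> 1" for x
      using w(3) [of x] by (simp add: divide_le_eq add_pos_nonneg) (smt (verit) zero_le_power2)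
    moreover have "0 \<le> w x / (1 + (x $ j)\<^sup>2)" for x
      using w(2) by simp
    ultimately have "\<bar>mpoly_eval f x\<bar> * \<bar>w x / (1 + (x $ j)\<^sup>2)\<bar> \<le> \<bar>mpoly_eval f x\<bar>" for x
      by (intro mult_left_le) (simp_all only: abs_of_nonneg abs_ge_zero)
    then show "AE x in \<mu>. norm (mpoly_eval f x * (w x / (1 + (x $ j)\<^sup>2))) \<le> norm (mpoly_eval f x)"
      by (simp only: real_norm_def abs_mult) simp
  qed measurable
  have bound: "\<bar>mpoly_eval (f * Q k) x * w x - mpoly_eval f x * (w x / (1 + (x $ j)\<^sup>2))\<bar>
      \<le> (\<eta> * mpoly_eval (f\<^sup>2) x + mpoly_eval ((h k)\<^sup>2) x / \<eta>) / 2" for k x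
  proof -
    let ?a = "\<bar>mpoly_eval f x\<bar>" and ?b = "\<bar>mpoly_eval (h k) x\<bar>"
    define p where "p = 1 + (x $ j)\<^sup>2"
    have p: "p \<ge> 1" by (simp add: p_def)
    have h: "mpoly_eval (h k) x = 1 - p * mpoly_eval (Q k) x"
      by (simp add: h_def p_def mpoly_eval_simps)
    have "mpoly_eval (Q k) x - 1 / p = - mpoly_eval (h k) x / p"
      unfolding h using p by (simp add: diff_divide_distrib)
    moreover have "mpoly_eval (f * Q k) x * w x - mpoly_eval f x * (w x / p)
        = mpoly_eval f x * (mpoly_eval (Q k) x - 1 / p) * w x"
      by (simp add: mpoly_eval_mult algebra_simps)
    ultimately have "\<bar>mpoly_eval (f * Q k) x * w x - mpoly_eval f x * (w x / p)\<bar> = ?a * ?b * (w x / p)"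
      using p w(2) [of x] by (simp add: abs_mult)
    also have "\<dots> \<le> ?a * ?b * 1"
      using p w(3) [of x] by (intro mult_left_mono) (auto simp: divide_le_eq)
    also have "\<dots> \<le> (\<eta> * ?a\<^sup>2 + ?b\<^sup>2 / \<eta>) / 2"
    proof -
      have "0 \<le> (\<eta> * ?a - ?b)\<^sup>2 / \<eta>" using \<eta> by simp
      also have "\<dots> = \<eta> * ?a\<^sup>2 + ?b\<^sup>2 / \<eta> - 2 * (?a * ?b)"
        using \<eta> by (simp add: power2_eq_square field_simps)
      finally show ?thesis by simp
    qed
    finally show ?thesis by (simp add: p_def mpoly_eval_power)
  qed
  have "dist (\<integral>x. mpoly_eval (f * Q k) x * w x \<partial>\<mu>) (\<integral>x. mpoly_eval f x * (w x / (1 + (x $ j)\<^sup>2)) \<partial>\<mu>) < e"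
    if "k \<ge> k0" for k
  proof -
    have "dist (\<integral>x. mpoly_eval (f * Q k) x * w x \<partial>\<mu>) (\<integral>x. mpoly_eval f x * (w x / (1 + (x $ j)\<^sup>2)) \<partial>\<mu>)
        = \<bar>\<integral>x. mpoly_eval (f * Q k) x * w x - mpoly_eval f x * (w x / (1 + (x $ j)\<^sup>2)) \<partial>\<mu>\<bar>"
      using int1 int2 by (simp add: dist_real_def)
    also have "\<dots> \<le> (\<integral>x. \<bar>mpoly_eval (f * Q k) x * w x - mpoly_eval f x * (w x / (1 + (x $ j)\<^sup>2))\<bar> \<partial>\<mu>)"
      by (rule integral_abs_bound)
    also have "\<dots> \<le> (\<integral>x. (\<eta> * mpoly_eval (f\<^sup>2) x + mpoly_eval ((h k)\<^sup>2) x / \<eta>) / 2 \<partial>\<mu>)"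
      using int1 int2 int by (intro integral_mono bound) auto
    also have "\<dots> = (\<eta> * F + moment_functional \<mu> ((h k)\<^sup>2) / \<eta>) / 2"
      using int by (simp add: F_def moment_functional_def)
    also have "\<dots> < e"
    proof -
      have "moment_functional \<mu> ((h k)\<^sup>2) / \<eta> < e" using k0 [OF that] \<eta> by (simp add: field_simps)
      with \<eta> show ?thesis by simp
    qed
    finally show ?thesis .
  qed
  then show "\<exists>k0. \<forall>k\<ge>k0. dist (\<integral>x. mpoly_eval (f * Q k) x * w x \<partial>\<mu>)
      (\<integral>x. mpoly_eval f x * (w x / (1 + (x $ j)\<^sup>2)) \<partial>\<mu>) < e" by blast
qed

section \<open>The algebra of fractions as functions\<close>

text \<open>In a list, repeated indices give powers of a factor, and appending multiplies
  denominators.\<close>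

definition inv_weight :: "'n list \<Rightarrow> real ^ 'n \<Rightarrow> real"
  where "inv_weight js x = (\<Prod>j\<leftarrow>js. 1 / (1 + (x $ j)\<^sup>2))"

lemma inv_weight_bounds: "0 < inv_weight js x" "inv_weight js x \<le> 1"
proof (induction js)
  case (Cons j js)
  have "0 < 1 / (1 + (x $ j)\<^sup>2)" "1 / (1 + (x $ j)\<^sup>2) \<le> 1" by (simp_all add: add_pos_nonneg)
  then show "0 < inv_weight (j # js) x" "inv_weight (j # js) x \<le> 1"
    using Cons mult_le_one [of "1 / (1 + (x $ j)\<^sup>2)" "inv_weight js x"] by (simp_all add: inv_weight_def)
qed (simp_all add: inv_weight_def)

lemma borel_measurable_inv_weight [measurable]: "inv_weight js \<in> borel_measurable borel"
  by (induction js) (simp_all add: inv_weight_def [abs_def])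

text \<open>One sequence \<open>Q\<close> serves for both measures because their moments agree. The
  approximating integrals coincide by the induction hypothesis for \<open>f * Q k\<close>, so the
  limits do.\<close>

lemma localized_integral_eq:
  fixes \<mu> \<nu> :: "(real ^ 'n::finite) measure"
  assumes \<mu>: "borel_measure \<mu>" "finite_moments \<mu>" and \<nu>: "borel_measure \<nu>" "finite_moments \<nu>"
    and eq: "moment_functional \<mu> = moment_functional \<nu>"
    and loc: "\<And>j. localizable (moment_functional \<mu>) j"
  shows "(\<integral>x. mpoly_eval f x * inv_weight js x \<partial>\<mu>) = (\<integral>x. mpoly_eval f x * inv_weight js x \<partial>\<nu>)"
proof (induction js arbitrary: f)
  case Nil
  then show ?case using eq by (simp add: inv_weight_def moment_functional_def fun_eq_iff)
next
  case (Cons j js)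
  obtain Q where Q: "(\<lambda>k. moment_functional \<mu> ((1 - (1 + (X j)\<^sup>2) * Q k)\<^sup>2)) \<longlonglongrightarrow> 0"
    using loc [of j] by (auto simp: localizable_def)
  note w = borel_measurable_inv_weight less_imp_le [OF inv_weight_bounds(1)] inv_weight_bounds(2)
  have "(\<integral>x. mpoly_eval f x * (inv_weight js x / (1 + (x $ j)\<^sup>2)) \<partial>\<mu>)
      = (\<integral>x. mpoly_eval f x * (inv_weight js x / (1 + (x $ j)\<^sup>2)) \<partial>\<nu>)"
    using localized_integral [OF \<mu> Q w, of f js] localized_integral [OF \<nu> Q [unfolded eq] w, of f js]
    unfolding Cons.IH by (rule LIMSEQ_unique)
  then show ?case by (simp add: inv_weight_def)
qed

definition localized_function :: "(real ^ 'n::finite \<Rightarrow> real) \<Rightarrow> bool"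
  where "localized_function g \<longleftrightarrow> (\<exists>f js. \<forall>x. g x = mpoly_eval f x * inv_weight js x)"

text \<open>Supplies the numerators needed to bring two fractions to a common denominator.\<close>

lemma localized_function_weight: "\<exists>f. \<forall>x. mpoly_eval f x * inv_weight js x = 1"
proof (induction js)
  case Nil
  then show ?case by (intro exI [of _ 1]) (simp add: inv_weight_def mpoly_eval_1)
next
  case (Cons j js)
  then obtain f where f: "\<And>x. mpoly_eval f x * inv_weight js x = 1" by blast
  have "mpoly_eval (f * (1 + (X j)\<^sup>2)) x * inv_weight (j # js) x = 1" for x
  proof -
    have "1 + (x $ j)\<^sup>2 \<noteq> 0" by (smt (verit) zero_le_power2)
    then show ?thesis using f [of x] by (simp add: inv_weight_def mpoly_eval_simps)
  qed
  then show ?case by blast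
qed

lemma inv_weight_append: "inv_weight (js @ ks) x = inv_weight js x * inv_weight ks x"
  by (simp add: inv_weight_def)

lemma localized_function_closed:
  assumes "localized_function g" "localized_function h"
  shows "localized_function (\<lambda>x. g x + h x)" "localized_function (\<lambda>x. g x * h x)"
proof -
  obtain f js where g: "\<And>x. g x = mpoly_eval f x * inv_weight js x"
    using assms(1) by (auto simp: localized_function_def)
  obtain f' ks where h: "\<And>x. h x = mpoly_eval f' x * inv_weight ks x"
    using assms(2) by (auto simp: localized_function_def)
  obtain r where r: "\<And>x. mpoly_eval r x * inv_weight js x = (1 :: real)"
    using localized_function_weight [of js] by blast
  obtain r' where r': "\<And>x. mpoly_eval r' x * inv_weight ks x = (1 :: real)"
    using localized_function_weight [of ks] by blast
  have "g x + h x = mpoly_eval (f * r' + f' * r) x * inv_weight (js @ ks) x" for x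
  proof -
    have "mpoly_eval (f * r' + f' * r) x * inv_weight (js @ ks) x
        = mpoly_eval f x * inv_weight js x * (mpoly_eval r' x * inv_weight ks x)
          + mpoly_eval f' x * inv_weight ks x * (mpoly_eval r x * inv_weight js x)"
      by (simp add: mpoly_eval_simps inv_weight_append algebra_simps)
    then show ?thesis by (simp add: g h r r')
  qed
  then show "localized_function (\<lambda>x. g x + h x)"
    unfolding localized_function_def by blast
  have "g x * h x = mpoly_eval (f * f') x * inv_weight (js @ ks) x" for x
    by (simp add: g h mpoly_eval_simps inv_weight_append)
  then show "localized_function (\<lambda>x. g x * h x)"
    unfolding localized_function_def by blast
qed

lemma localized_function_const: "localized_function (\<lambda>x. c)"
  unfolding localized_function_def
  by (rule exI [of _ "Const c"], rule exI [of _ "[]"]) (simp add: inv_weight_def mpoly_eval_Const)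

lemma localized_function_sum:
  "(\<And>i. i \<in> A \<Longrightarrow> localized_function (g i)) \<Longrightarrow> localized_function (\<lambda>x. \<Sum>i\<in>A. g i x)"
  by (induction A rule: infinite_finite_induct)
    (auto intro: localized_function_const localized_function_closed)

text \<open>Up to an affine change of coordinates, each coordinate line is mapped onto a circle minus a
  point.\<close>

definition circle_coords :: "real ^ 'n \<Rightarrow> (real ^ 'n) \<times> (real ^ 'n)"
  where "circle_coords x = (\<chi> j. 1 / (1 + (x $ j)\<^sup>2), \<chi> j. x $ j / (1 + (x $ j)\<^sup>2))"

lemma localized_function_circle_coords:
  "localized_function (\<lambda>x. fst (circle_coords x) $ j)" "localized_function (\<lambda>x. snd (circle_coords x) $ j)"
  unfolding localized_function_def circle_coords_def
  by (rule exI [of _ 1], rule exI [of _ "[j]"], simp add: inv_weight_def mpoly_eval_1)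
    (rule exI [of _ "X j"], rule exI [of _ "[j]"], simp add: inv_weight_def mpoly_eval_X)

text \<open>The localized functions form an algebra that contains the circle coordinates. Only the
  linear case needs an argument, by expansion in the standard basis.\<close>

lemma localized_function_real_polynomial:
  assumes "real_polynomial_function g"
  shows "localized_function (\<lambda>x. g (circle_coords x))"
  using assms
proof induction
  case (linear g)
  interpret bounded_linear g by fact
  have "g (a, b) = (\<Sum>j\<in>UNIV. g (axis j 1, 0) * a $ j) + (\<Sum>j\<in>UNIV. g (0, axis j 1) * b $ j)" for a b
  proof -
    have "(a, b) = (\<Sum>j\<in>UNIV. a $ j *\<^sub>R (axis j 1, 0)) + (\<Sum>j\<in>UNIV. b $ j *\<^sub>R (0, axis j 1))"
    proof -
      have "(\<Sum>j\<in>UNIV. a $ j *\<^sub>R axis j 1) = a" for a :: "real ^ 'a"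
        using basis_expansion [of a] by (simp add: scalar_mult_eq_scaleR)
      then show ?thesis by (simp add: prod_eq_iff fst_sum snd_sum)
    qed
    from arg_cong [OF this, of g] show ?thesis
      by (simp only: add sum scaleR real_scaleR_def mult.commute)
  qed
  from this [of "fst (circle_coords x)" "snd (circle_coords x)" for x] show ?case
    by (simp, intro localized_function_closed localized_function_sum localized_function_const
        localized_function_circle_coords)
qed (auto intro: localized_function_const localized_function_closed)

lemma finite_measure_of_moments:
  assumes "finite_moments \<mu>"
  shows "finite_measure \<mu>"
proof
  have "integrable \<mu> (\<lambda>x. 1 :: real)"
    using assms unfolding finite_moments_def by (auto dest: spec [of _ "\<lambda>_. 0"])
  then show "emeasure \<mu> (space \<mu>) \<noteq> \<infinity>" by (simp add: integrable_iff_bounded less_top)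
qed

text \<open>Closed sets form an intersection-stable generator, and the indicator of a nonempty
  closed set is the pointwise limit of the continuous functions
  \<open>max 0 (1 - n * infdist y S)\<close>.\<close>

lemma finite_borel_measure_eqI:
  fixes \<mu> \<nu> :: "'a::metric_space measure"
  assumes "finite_measure \<mu>" "finite_measure \<nu>" and sets: "sets \<mu> = sets borel" "sets \<nu> = sets borel"
    and eq: "\<And>\<phi> :: 'a \<Rightarrow> real. continuous_on UNIV \<phi> \<Longrightarrow> (\<And>y. 0 \<le> \<phi> y \<and> \<phi> y \<le> 1) \<Longrightarrow> (\<integral>y. \<phi> y \<partial>\<mu>) = (\<integral>y. \<phi> y \<partial>\<nu>)"
  shows "\<mu> = \<nu>"
proof (rule measure_eqI_generator_eq)
  show "Int_stable (Collect closed :: 'a set set)" by (auto simp: Int_stable_def)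
  show "Collect closed \<subseteq> Pow (UNIV :: 'a set)" by simp
  show "sets \<mu> = sigma_sets UNIV (Collect closed)" "sets \<nu> = sigma_sets UNIV (Collect closed)"
    by (simp_all add: sets borel_eq_closed)
  interpret \<mu>: finite_measure \<mu> by fact
  interpret \<nu>: finite_measure \<nu> by fact
  show "range (\<lambda>_ :: nat. UNIV :: 'a set) \<subseteq> Collect closed" by auto
  show "(\<Union>_ :: nat. UNIV :: 'a set) = UNIV" by simp
  show "emeasure \<mu> UNIV \<noteq> \<infinity>" by simp
  fix S :: "'a set" assume "S \<in> Collect closed"
  then have S: "closed S" by simp
  show "emeasure \<mu> S = emeasure \<nu> S"
  proof (cases "S = {}")
    case False
    define \<phi> where "\<phi> n y = max 0 (1 - real n * infdist y S)" for n y
    have cont: "continuous_on UNIV (\<phi> n)" for n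
      unfolding \<phi>_def by (intro continuous_intros)
    have bounds: "0 \<le> \<phi> n y \<and> \<phi> n y \<le> 1" for n y
      by (auto simp: \<phi>_def infdist_nonneg)
    have lim: "(\<lambda>n. \<phi> n y) \<longlonglongrightarrow> indicator S y" for y
    proof (cases "y \<in> S")
      case True
      then show ?thesis by (simp add: \<phi>_def)
    next
      case out: False
      then have pos: "infdist y S > 0"
        using in_closed_iff_infdist_zero [OF S False] infdist_nonneg [of y S] by (simp add: less_le)
      obtain n0 :: nat where n0: "1 / infdist y S \<le> real n0" using real_arch_simple by blast
      have "\<forall>\<^sub>F n in sequentially. \<phi> n y = 0"
        using eventually_ge_at_top [of n0]
      proof eventually_elim
        case (elim n)
        then have "1 / infdist y S \<le> real n" using n0 by linarith
        then show ?case using pos by (simp add: \<phi>_def field_simps)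
      qed
      then show ?thesis using out by (simp add: tendsto_eventually)
    qed
    have conv: "(\<lambda>n. \<integral>y. \<phi> n y \<partial>\<rho>) \<longlonglongrightarrow> measure \<rho> S"
      if "finite_measure \<rho>" "sets \<rho> = sets borel" for \<rho>
    proof -
      interpret finite_measure \<rho> by fact
      have meas: "\<phi> n \<in> borel_measurable \<rho>" for n
        using borel_measurable_continuous_onI [OF cont] by (simp cong: measurable_cong_sets add: that(2))
      have "S \<in> sets \<rho>" using S that(2) by simp
      have "(\<lambda>n. \<integral>y. \<phi> n y \<partial>\<rho>) \<longlonglongrightarrow> (\<integral>y. indicator S y \<partial>\<rho>)"
      proof (rule integral_dominated_convergence [where w = "\<lambda>_. 1"])
        show "AE y in \<rho>. norm (\<phi> n y) \<le> 1" for n using bounds by simp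
      qed (use meas \<open>S \<in> sets \<rho>\<close> lim in auto)
      then show ?thesis using \<open>S \<in> sets \<rho>\<close> sets.sets_into_space by (simp add: Int_absorb2)
    qed
    have "measure \<mu> S = measure \<nu> S"
      using conv [OF assms(1) sets(1)] conv [OF assms(2) sets(2)] eq [OF cont bounds]
      by (simp add: LIMSEQ_unique)
    then show ?thesis by (simp add: \<mu>.emeasure_eq_measure \<nu>.emeasure_eq_measure)
  qed simp
qed

text \<open>\<open>circle_coords\<close> maps into a ball, on which polynomials approximate
  continuous functions uniformly. Polynomials in the circle coordinates are localized functions and
  have equal integrals, so the image measures agree; \<open>circle_coords\<close> has a Borel left
  inverse, which recovers the measures.\<close>

lemma localizable_imp_determinate:
  fixes \<mu> :: "(real ^ 'n::finite) measure"
  assumes \<mu>: "borel_measure \<mu>" "finite_moments \<mu>" and loc: "\<And>j. localizable (moment_functional \<mu>) j"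
  shows "determinate \<mu>"
  unfolding determinate_def
proof (intro allI impI, elim conjE)
  fix \<nu> :: "(real ^ 'n) measure"
  assume \<nu>: "borel_measure \<nu>" "finite_moments \<nu>" and eq: "moment_functional \<mu> = moment_functional \<nu>"
  let ?\<Psi> = "circle_coords :: real ^ 'n \<Rightarrow> _"
  have sets: "sets \<mu> = sets borel" "sets \<nu> = sets borel"
    using \<mu> \<nu> by (simp_all add: borel_measure_def)
  interpret \<mu>: finite_measure \<mu> using \<mu>(2) by (rule finite_measure_of_moments)
  interpret \<nu>: finite_measure \<nu> using \<nu>(2) by (rule finite_measure_of_moments)
  have \<Psi>_borel: "?\<Psi> \<in> borel_measurable borel"
  proof (rule borel_measurable_continuous_onI)
    have "1 + (x $ j)\<^sup>2 \<noteq> 0" for x :: "real ^ 'n" and j by (smt (verit) zero_le_power2)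
    then show "continuous_on UNIV ?\<Psi>"
      unfolding circle_coords_def by (intro continuous_intros) auto
  qed
  then have \<Psi>: "?\<Psi> \<in> borel_measurable \<mu>" "?\<Psi> \<in> borel_measurable \<nu>"
    by (simp_all cong: measurable_cong_sets add: sets)
  have loc_eq: "(\<integral>x. g x \<partial>\<mu>) = (\<integral>x. g x \<partial>\<nu>)" if "localized_function g" for g
    using that localized_integral_eq [OF \<mu> \<nu> eq loc] unfolding localized_function_def
    by (metis (no_types, lifting) Bochner_Integration.integral_cong)
  define m where "m = measure \<mu> UNIV"
  have "m = measure \<nu> UNIV"
  proof -
    have "space \<mu> = UNIV" "space \<nu> = UNIV" using sets by (auto dest: sets_eq_imp_space_eq)
    then show ?thesis using loc_eq [OF localized_function_const [of 1]] by (simp add: m_def)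
  qed
  have \<Psi>_bound: "norm (?\<Psi> x) \<le> 2 * CARD('n)" for x
  proof -
    have u: "\<bar>1 / (1 + (x $ j)\<^sup>2)\<bar> \<le> 1" for j by (simp add: add_pos_nonneg)
    have v: "\<bar>x $ j / (1 + (x $ j)\<^sup>2)\<bar> \<le> 1" for j
    proof -
      have "\<bar>x $ j\<bar> \<le> 1 + (x $ j)\<^sup>2"
        using zero_le_power2 [of "\<bar>x $ j\<bar> - 1"] by (simp add: power2_eq_square algebra_simps)
      then show ?thesis by (simp add: abs_divide add_pos_nonneg)
    qed
    have le: "norm y \<le> CARD('n)" if "\<And>j. \<bar>y $ j\<bar> \<le> 1" for y :: "real ^ 'n"
      using norm_le_l1_cart [of y] sum_mono [of UNIV "\<lambda>j. \<bar>y $ j\<bar>" "\<lambda>_. 1"] that by simp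
    have "norm (?\<Psi> x) \<le> norm (fst (?\<Psi> x)) + norm (snd (?\<Psi> x))"
      using norm_Pair_le [of "fst (?\<Psi> x)" "snd (?\<Psi> x)"] by simp
    also have "\<dots> \<le> real CARD('n) + real CARD('n)"
      by (intro add_mono le) (use u v in \<open>simp_all add: circle_coords_def\<close>)
    finally show ?thesis by simp
  qed
  have \<phi>_eq: "(\<integral>x. \<phi> (?\<Psi> x) \<partial>\<mu>) = (\<integral>x. \<phi> (?\<Psi> x) \<partial>\<nu>)"
    if cont: "continuous_on UNIV \<phi>" and bounds: "\<And>y. 0 \<le> \<phi> y \<and> \<phi> y \<le> 1" for \<phi> :: "(real ^ 'n) \<times> (real ^ 'n) \<Rightarrow> real"
  proof -
    have close: "\<bar>(\<integral>x. \<phi> (?\<Psi> x) \<partial>\<mu>) - (\<integral>x. \<phi> (?\<Psi> x) \<partial>\<nu>)\<bar> \<le> 2 * (e * m)" if "e > 0" for e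
    proof -
      obtain g where g: "real_polynomial_function g"
          "\<And>y. y \<in> cball 0 (2 * CARD('n)) \<Longrightarrow> \<bar>\<phi> y - g y\<bar> < e"
        using Stone_Weierstrass_real_polynomial_function [of "cball 0 (2 * CARD('n))" \<phi> e] \<open>e > 0\<close>
          continuous_on_subset [OF cont] by (metis compact_cball subset_UNIV)
      have "\<phi> \<circ> ?\<Psi> \<in> borel_measurable borel" "g \<circ> ?\<Psi> \<in> borel_measurable borel"
        using \<Psi>_borel borel_measurable_continuous_onI [OF cont]
          borel_measurable_continuous_onI [OF continuous_on_polymonial_function [of g UNIV]] g(1)
        by (auto intro: measurable_comp simp: real_polynomial_function_eq)
      then have meas: "(\<lambda>x. \<phi> (?\<Psi> x)) \<in> borel_measurable borel" "(\<lambda>x. g (?\<Psi> x)) \<in> borel_measurable borel"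
        by (simp_all add: comp_def)
      have near: "\<bar>\<phi> (?\<Psi> x) - g (?\<Psi> x)\<bar> \<le> e" for x
        using g(2) [of "?\<Psi> x"] \<Psi>_bound [of x] by simp
      have diff: "\<bar>(\<integral>x. \<phi> (?\<Psi> x) \<partial>\<rho>) - (\<integral>x. g (?\<Psi> x) \<partial>\<rho>)\<bar> \<le> e * measure \<rho> UNIV"
        if "finite_measure \<rho>" and \<rho>: "sets \<rho> = sets borel" for \<rho>
      proof -
        interpret finite_measure \<rho> by fact
        have [measurable]: "(\<lambda>x. \<phi> (?\<Psi> x)) \<in> borel_measurable \<rho>" "(\<lambda>x. g (?\<Psi> x)) \<in> borel_measurable \<rho>"
          using meas by (simp_all cong: measurable_cong_sets add: \<rho>)
        have int: "integrable \<rho> (\<lambda>x. \<phi> (?\<Psi> x))"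
          using bounds by (intro integrable_const_bound [where B = 1]) auto
        have "\<bar>g (?\<Psi> x)\<bar> \<le> 1 + e" for x
          using near [of x] bounds [of "?\<Psi> x"] by linarith
        then have int': "integrable \<rho> (\<lambda>x. g (?\<Psi> x))"
          by (intro integrable_const_bound [where B = "1 + e"]) auto
        have "\<bar>(\<integral>x. \<phi> (?\<Psi> x) \<partial>\<rho>) - (\<integral>x. g (?\<Psi> x) \<partial>\<rho>)\<bar> = \<bar>\<integral>x. \<phi> (?\<Psi> x) - g (?\<Psi> x) \<partial>\<rho>\<bar>"
          using int int' by simp
        also have "\<dots> \<le> (\<integral>x. \<bar>\<phi> (?\<Psi> x) - g (?\<Psi> x)\<bar> \<partial>\<rho>)" by (rule integral_abs_bound)
        also have "\<dots> \<le> (\<integral>x. e \<partial>\<rho>)" using int int' by (intro integral_mono near) auto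
        also have "\<dots> = e * measure \<rho> UNIV"
          using sets_eq_imp_space_eq [OF \<rho>] by (simp add: mult.commute)
        finally show ?thesis .
      qed
      have "(\<integral>x. g (?\<Psi> x) \<partial>\<mu>) = (\<integral>x. g (?\<Psi> x) \<partial>\<nu>)"
        by (intro loc_eq localized_function_real_polynomial g(1))
      then show ?thesis
        using diff [OF \<mu>.finite_measure_axioms sets(1)] diff [OF \<nu>.finite_measure_axioms sets(2)]
        unfolding m_def [symmetric] \<open>m = measure \<nu> UNIV\<close> [symmetric] by linarith
    qed
    show ?thesis
    proof (rule ccontr)
      assume neq: "\<not> ?thesis"
      define d where "d = \<bar>(\<integral>x. \<phi> (?\<Psi> x) \<partial>\<mu>) - (\<integral>x. \<phi> (?\<Psi> x) \<partial>\<nu>)\<bar>"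
      have pos: "d > 0" using neq by (simp add: d_def)
      have "m \<ge> 0" by (simp add: m_def)
      define e where "e = d / (4 * (m + 1))"
      have "e > 0" using pos \<open>m \<ge> 0\<close> by (simp add: e_def)
      have "2 * (e * m) \<le> 2 * (e * (m + 1))" using \<open>e > 0\<close> by simp
      also have "\<dots> = d / 2" using \<open>m \<ge> 0\<close> by (simp add: e_def field_simps)
      finally show False using close [OF \<open>e > 0\<close>, folded d_def] pos by linarith
    qed
  qed
  have distr_eq: "distr \<mu> borel ?\<Psi> = distr \<nu> borel ?\<Psi>"
  proof (rule finite_borel_measure_eqI)
    show "finite_measure (distr \<mu> borel ?\<Psi>)" "finite_measure (distr \<nu> borel ?\<Psi>)"
      using \<Psi> by (simp_all add: \<mu>.finite_measure_distr \<nu>.finite_measure_distr)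
    fix \<phi> :: "(real ^ 'n) \<times> (real ^ 'n) \<Rightarrow> real"
    assume "continuous_on UNIV \<phi>" "\<And>y. 0 \<le> \<phi> y \<and> \<phi> y \<le> 1"
    from \<phi>_eq [OF this] show "(\<integral>y. \<phi> y \<partial>distr \<mu> borel ?\<Psi>) = (\<integral>y. \<phi> y \<partial>distr \<nu> borel ?\<Psi>)"
      using \<Psi> borel_measurable_continuous_onI [OF \<open>continuous_on UNIV \<phi>\<close>] by (simp add: integral_distr)
  qed simp_all
  \<comment> \<open>The quotient of the two coordinates of a circle point is \<open>x $ j\<close>.
    Elsewhere division by 0 has the value 0, and the map is still Borel.\<close>
  define \<Theta> :: "(real ^ 'n) \<times> (real ^ 'n) \<Rightarrow> real ^ 'n" where "\<Theta> y = (\<chi> j. snd y $ j / fst y $ j)" for y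
  have \<Theta>_borel: "\<Theta> \<in> borel_measurable borel"
  proof -
    have "(\<lambda>y :: (real ^ 'n) \<times> (real ^ 'n). fst y $ j) \<in> borel_measurable borel"
      "(\<lambda>y :: (real ^ 'n) \<times> (real ^ 'n). snd y $ j) \<in> borel_measurable borel" for j
      by (intro borel_measurable_continuous_onI continuous_intros)+
    then show ?thesis
      unfolding \<Theta>_def by (subst borel_measurable_euclidean_space) (auto simp: Basis_vec_def inner_axis)
  qed
  have \<Theta>: "\<Theta> (?\<Psi> x) = x" for x
  proof -
    have "1 + (x $ j)\<^sup>2 \<noteq> 0" for j by (smt (verit) zero_le_power2)
    then show ?thesis by (simp add: \<Theta>_def circle_coords_def vec_eq_iff)
  qed
  have recover: "distr (distr \<rho> borel ?\<Psi>) borel \<Theta> = \<rho>" if "sets \<rho> = sets borel" for \<rho>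
  proof -
    note \<rho> = that
    have "?\<Psi> \<in> borel_measurable \<rho>" using \<Psi>_borel by (simp cong: measurable_cong_sets add: \<rho>)
    then have "distr (distr \<rho> borel ?\<Psi>) borel \<Theta> = distr \<rho> borel (\<lambda>x. x)"
      using \<Theta>_borel by (simp add: distr_distr comp_def \<Theta>)
    also have "\<dots> = distr \<rho> \<rho> (\<lambda>x. x)" by (rule distr_cong) (simp_all add: \<rho>)
    finally show ?thesis by simp
  qed
  have "\<mu> = distr (distr \<mu> borel ?\<Psi>) borel \<Theta>"
    by (rule recover [OF sets(1), symmetric])
  also have "\<dots> = distr (distr \<nu> borel ?\<Psi>) borel \<Theta>"
    by (simp only: distr_eq)
  also have "\<dots> = \<nu>"
    by (rule recover [OF sets(2)])
  finally show "\<mu> = \<nu>" .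
qed

section \<open>Existence\<close>

text \<open>A point may occur several times in the list and then carries the sum of its weights. The
  induction runs over the list with a fixed finite set \<open>A\<close> of points.\<close>

lemma integral_pmf_of_list:
  fixes f :: "'a \<Rightarrow> real"
  assumes "pmf_of_list_wf xs"
  shows "(\<integral>x. f x \<partial>measure_pmf (pmf_of_list xs)) = (\<Sum>(x, w)\<leftarrow>xs. w * f x)"
proof -
  have "(\<integral>x. f x \<partial>measure_pmf (pmf_of_list xs)) = (\<Sum>a\<in>set (map fst xs). f a * pmf (pmf_of_list xs) a)"
    using set_pmf_of_list [OF assms] by (intro integral_measure_pmf_real) auto
  also have "\<dots> = (\<Sum>a\<in>set (map fst xs). f a * sum_list (map snd (filter (\<lambda>z. fst z = a) xs)))"
    by (simp add: pmf_pmf_of_list [OF assms])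
  also have "\<dots> = (\<Sum>(x, w)\<leftarrow>xs. w * f x)"
  proof -
    have "(\<Sum>a\<in>A. f a * sum_list (map snd (filter (\<lambda>z. fst z = a) ys))) = (\<Sum>(x, w)\<leftarrow>ys. w * f x)"
      if "finite A" "set (map fst ys) \<subseteq> A" for A and ys :: "('a \<times> real) list"
      using that(2)
    proof (induction ys)
      case (Cons y ys)
      have "(\<Sum>a\<in>A. f a * sum_list (map snd (filter (\<lambda>z. fst z = a) (y # ys))))
          = (\<Sum>a\<in>A. (if a = fst y then f a * snd y else 0) + f a * sum_list (map snd (filter (\<lambda>z. fst z = a) ys)))"
        by (intro sum.cong) (auto simp: distrib_left)
      also have "\<dots> = f (fst y) * snd y + (\<Sum>a\<in>A. f a * sum_list (map snd (filter (\<lambda>z. fst z = a) ys)))"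
        using Cons.prems \<open>finite A\<close> by (simp add: sum.distrib)
      finally show ?case using Cons by (simp add: case_prod_unfold mult.commute)
    qed simp
    then show ?thesis by simp
  qed
  finally show ?thesis .
qed

lemma representsI:
  fixes L :: "('n::finite, real) mpoly \<Rightarrow> real"
  assumes "linear L" and "sets \<mu> = sets borel"
    and int: "\<And>a. integrable \<mu> (\<lambda>x. \<Prod>j\<in>UNIV. x $ j ^ a j)"
    and eq: "\<And>a. (\<integral>x. (\<Prod>j\<in>UNIV. x $ j ^ a j) \<partial>\<mu>) = L (\<Prod>j\<in>UNIV. X j ^ a j)"
  shows "represents \<mu> L"
proof -
  have "finite_moments \<mu>" using int by (simp add: finite_moments_def)
  moreover from \<open>linear L\<close> moment_functional_linear [OF this] have "L = moment_functional \<mu>"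
    by (rule linear_mpoly_ext) (simp add: moment_functional_def mpoly_eval_simps eq)
  ultimately show ?thesis using assms(2) by (simp add: represents_def borel_measure_def)
qed

lemma psd_eq_0:
  assumes "linear L" "psd L" "L 1 = 0"
  shows "L f = 0"
  using psd_Cauchy_Schwarz [OF assms(1,2), of 1 f] assms(3) by simp

text \<open>If \<open>L 1 = 0\<close>, then \<open>L\<close> vanishes and the null measure
  represents it. Otherwise the atomic approximations are normalised to probability measures, and
  multiplying the limit measure by \<open>L 1\<close> restores the mass.\<close>

lemma localizable_imp_represents:
  fixes L :: "('n::finite, real) mpoly \<Rightarrow> real"
  assumes L: "linear L" "psd L" and loc: "\<And>j. j \<noteq> l \<Longrightarrow> localizable L j"
  shows "\<exists>\<mu>. represents \<mu> L"
proof (cases "L 1 = 0")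
  case True
  have "represents (null_measure borel) L"
    using psd_eq_0 [OF L True] by (intro representsI L(1)) auto
  then show ?thesis by blast
next
  case False
  then have pos: "L 1 > 0"
    using L(2) unfolding psd_def by (metis less_le one_power2)
  define approx where "approx s xs \<longleftrightarrow> (\<forall>(x, w)\<in>set xs. 0 \<le> w) \<and> (\<forall>a. (\<forall>j. a j \<le> 2 * s) \<longrightarrow>
      \<bar>(\<Sum>(x, w)\<leftarrow>xs. w * (\<Prod>j\<in>UNIV. x $ j ^ a j)) - L (\<Prod>j\<in>UNIV. X j ^ a j)\<bar> < 1 / Suc s)"
    for s and xs :: "((real ^ 'n) \<times> real) list"
  have "\<exists>xs. approx s xs" for s
  proof (rule psd_atomic_approximation [OF L, where l = l and s = s and \<epsilon> = "1 / Suc s"])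
    fix xs :: "((real ^ 'n) \<times> real) list"
    assume "\<And>x w. (x, w) \<in> set xs \<Longrightarrow> 0 \<le> w"
      and "\<And>a. (\<And>j. a j \<le> 2 * s) \<Longrightarrow>
        \<bar>(\<Sum>(x, w)\<leftarrow>xs. w * (\<Prod>j\<in>UNIV. x $ j ^ a j)) - L (\<Prod>j\<in>UNIV. X j ^ a j)\<bar> < 1 / Suc s"
    then show "\<exists>xs. approx s xs" by (intro exI [of _ xs]) (auto simp: approx_def)
  qed (auto intro: loc)
  then obtain xs where approx: "\<And>s. approx s (xs s)" by metis
  have xs_nonneg: "0 \<le> w" if "(x, w) \<in> set (xs s)" for s x w
    using approx [of s] that by (auto simp: approx_def)
  have xs: "\<bar>(\<Sum>(x, w)\<leftarrow>xs s. w * (\<Prod>j\<in>UNIV. x $ j ^ a j)) - L (\<Prod>j\<in>UNIV. X j ^ a j)\<bar> < 1 / Suc s"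
    if "\<And>j. a j \<le> 2 * s" for s a
    using approx [of s] that by (simp add: approx_def)
  define I where "I s a = (\<Sum>(x, w)\<leftarrow>xs s. w * (\<Prod>j\<in>UNIV. x $ j ^ a j))" for s and a :: "'n \<Rightarrow> nat"
  have I_lim: "(\<lambda>s. I s a) \<longlonglongrightarrow> L (\<Prod>j\<in>UNIV. X j ^ a j)" for a
  proof (rule LIM_zero_cancel, rule Lim_null_comparison [OF _ lim_1_over_n])
    \<comment> \<open>The sum dominates every exponent, and the successor makes \<open>s\<close>
      positive for the division by \<open>real s\<close>.\<close>
    have "norm (I s a - L (\<Prod>j\<in>UNIV. X j ^ a j)) \<le> 1 / real s" if "s \<ge> Suc (\<Sum>j\<in>UNIV. a j)" for s
    proof -
      have "a j \<le> 2 * s" for j using member_le_sum [of j UNIV a] that by simp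
      from xs [where a = a, OF this] have "norm (I s a - L (\<Prod>j\<in>UNIV. X j ^ a j)) \<le> 1 / Suc s"
        by (simp add: I_def)
      also have "\<dots> \<le> 1 / real s" using that by (intro divide_left_mono) auto
      finally show ?thesis .
    qed
    then show "\<forall>\<^sub>F s in sequentially. norm (I s a - L (\<Prod>j\<in>UNIV. X j ^ a j)) \<le> 1 / real s"
      unfolding eventually_sequentially by blast
  qed
  define Z where "Z s = I s (\<lambda>_. 0)" for s
  have "Z \<longlonglongrightarrow> L 1" using I_lim [of "\<lambda>_. 0"] unfolding Z_def by simp
  then have "\<forall>\<^sub>F s in sequentially. 0 < Z s" using pos by (rule order_tendstoD(1))
  \<comment> \<open>The total masses \<open>Z s\<close> are positive from \<open>s0\<close> on, and
    the shift by \<open>s0\<close> makes every member of the sequence normalisable.\<close>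
  then obtain s0 where s0: "\<And>s. s \<ge> s0 \<Longrightarrow> 0 < Z s" by (auto simp: eventually_sequentially)
  define ps where "ps s = map (\<lambda>(x, w). (x, w / Z (s + s0))) (xs (s + s0))" for s
  have ps_sum: "(\<Sum>(x, w)\<leftarrow>ps s. w * f x) = (\<Sum>(x, w)\<leftarrow>xs (s + s0). w * f x) / Z (s + s0)" for s f
  proof -
    have "(\<Sum>(x, w)\<leftarrow>ys. w / z * f x) = (\<Sum>(x, w)\<leftarrow>ys. w * f x) / z"
      for ys :: "((real ^ 'n) \<times> real) list" and z
      by (induction ys) (auto simp: add_divide_distrib)
    then show ?thesis by (simp add: ps_def comp_def case_prod_unfold)
  qed
  have wf: "pmf_of_list_wf (ps s)" for s
  proof (rule pmf_of_list_wfI)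
    have Z: "0 < Z (s + s0)" by (rule s0) simp
    show "0 \<le> w" if "w \<in> set (map snd (ps s))" for w
      using that Z by (auto simp: ps_def dest: xs_nonneg)
    have "sum_list (map snd (ps s)) = (\<Sum>(x, w)\<leftarrow>ps s. w * 1)" by (simp add: case_prod_unfold)
    also have "\<dots> = 1" unfolding ps_sum using Z by (simp add: Z_def I_def)
    finally show "sum_list (map snd (ps s)) = 1" .
  qed
  have "(\<lambda>s. \<integral>x. (\<Prod>j\<in>UNIV. x $ j ^ a j) \<partial>measure_pmf (pmf_of_list (ps s)))
      \<longlonglongrightarrow> L (\<Prod>j\<in>UNIV. X j ^ a j) / L 1" for a
  proof -
    have "(\<lambda>s. I (s + s0) a / Z (s + s0)) \<longlonglongrightarrow> L (\<Prod>j\<in>UNIV. X j ^ a j) / L 1"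
      using pos by (intro tendsto_divide LIMSEQ_ignore_initial_segment I_lim \<open>Z \<longlonglongrightarrow> L 1\<close>) auto
    then show ?thesis by (simp add: integral_pmf_of_list [OF wf] ps_sum I_def)
  qed
  from moment_sequence_limit [OF finite_set_pmf_of_list [OF wf] this]
  obtain \<mu> :: "(real ^ 'n) measure" where \<mu>: "sets \<mu> = sets borel"
    and int: "\<And>a. integrable \<mu> (\<lambda>x. \<Prod>j\<in>UNIV. x $ j ^ a j)"
    and eq: "\<And>a. (\<integral>x. (\<Prod>j\<in>UNIV. x $ j ^ a j) \<partial>\<mu>) = L (\<Prod>j\<in>UNIV. X j ^ a j) / L 1"
    by blast
  have "represents (density \<mu> (\<lambda>_. L 1)) L"
  proof (rule representsI [OF L(1)])
    show "sets (density \<mu> (\<lambda>_. L 1)) = sets borel" using \<mu> by simp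
    fix a :: "'n \<Rightarrow> nat"
    have meas: "(\<lambda>x. \<Prod>j\<in>UNIV. x $ j ^ a j) \<in> borel_measurable \<mu>"
      using int by (rule borel_measurable_integrable)
    show "integrable (density \<mu> (\<lambda>_. L 1)) (\<lambda>x. \<Prod>j\<in>UNIV. x $ j ^ a j)"
      using pos int by (subst integrable_density [OF meas]) auto
    show "(\<integral>x. (\<Prod>j\<in>UNIV. x $ j ^ a j) \<partial>density \<mu> (\<lambda>_. L 1)) = L (\<Prod>j\<in>UNIV. X j ^ a j)"
      using pos int by (subst integral_density [OF meas]) (auto simp: eq)
  qed
  then show ?thesis by blast
qed

lemma localizableI:
  assumes "(\<lambda>k. L (mpoly_abs_sq (1 - (1 + (X j)\<^sup>2) * q k * mpoly_cnj (q k)))) \<longlonglongrightarrow> 0"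
  shows "localizable L j"
  unfolding localizable_def
proof (rule exI, rule conjI, rule allI)
  show "\<exists>a b. mpoly_abs_sq (q k) = a\<^sup>2 + b\<^sup>2" for k
    by (auto simp: mpoly_abs_sq_def)
  show "(\<lambda>k. L ((1 - (1 + (X j)\<^sup>2) * mpoly_abs_sq (q k))\<^sup>2)) \<longlonglongrightarrow> 0"
    using assms by (simp add: mpoly_abs_sq_one_minus)
qed

text \<open>Index types are finite and nonempty, so there is at least one variable, and any index
  \<open>l\<close> may be taken as the last one. Determinacy is stated for all representing measures
  and so covers the one obtained.\<close>

theorem theorem0p1:
  fixes L :: "('n::finite, real) mpoly \<Rightarrow> real"
    and l :: 'n  \<comment> \<open>the index of the last variable\<close>
  assumes "linear L" and "psd L"
    and "\<And>j. j \<noteq> l \<Longrightarrow> \<exists>q :: nat \<Rightarrow> ('n, complex) mpoly.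
           (\<lambda>k. L (mpoly_abs_sq (1 - (1 + (X j)\<^sup>2) * q k * mpoly_cnj (q k)))) \<longlonglongrightarrow> 0"
  shows "(\<exists>\<mu>. represents \<mu> L) \<and>
    ((\<exists>q :: nat \<Rightarrow> ('n, complex) mpoly.
        (\<lambda>k. L (mpoly_abs_sq (1 - (1 + (X l)\<^sup>2) * q k * mpoly_cnj (q k)))) \<longlonglongrightarrow> 0)
      \<longrightarrow> (\<forall>\<mu>. represents \<mu> L \<longrightarrow> determinate \<mu>))"
proof (intro conjI impI allI)
  have loc: "localizable L j" if "j \<noteq> l" for j
    using assms(3) [OF that] by (elim exE) (rule localizableI)
  with assms(1,2) show "\<exists>\<mu>. represents \<mu> L" by (rule localizable_imp_represents)
  fix \<mu>
  assume "\<exists>q :: nat \<Rightarrow> ('n, complex) mpoly.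
      (\<lambda>k. L (mpoly_abs_sq (1 - (1 + (X l)\<^sup>2) * q k * mpoly_cnj (q k)))) \<longlonglongrightarrow> 0"
  then have "localizable L l" by (elim exE) (rule localizableI)
  with loc have "localizable L j" for j by (cases "j = l") auto
  moreover assume "represents \<mu> L"
  ultimately show "determinate \<mu>"
    unfolding represents_def by (metis localizable_imp_determinate)
qed

end
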